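(* For any group $G$, $|L(G)|$ is $(d(G)-3)$-connected. In particular, if $d(G)=\infty$ then $|L(G)|$ is contractible.
   Context: $L(G)$ is the poset of proper nontrivial subgroups of $G$ ordered by inclusion, and $|L(G)|$ the geometric realization of its order complex. $d(G)$ is the length of a chief series of $G$ (a maximal chain $1=N_0\triangleleft N_1\triangleleft\cdots\triangleleft N_d=G$ in the lattice of normal subgroups of $G$, of length $d$), i.e. the rank of the lattice of normal subgroups; $d(G)=\infty$ if $G$ has no chief series. Convention: a space is $(-1)$-connected iff nonempty, every space is $(-2)$-connected, and the empty space is not $0$-connected. *)

theory Defs
  imports "HOL-Analysis.Analysis" "HOL-Algebra.Algebra"
begin

definition proper_nontrivial_subgroups :: "('a, 'b) monoid_scheme \<Rightarrow> 'a set set" where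
  "proper_nontrivial_subgroups G =
     {H. subgroup H G \<and> H \<noteq> carrier G \<and> H \<noteq> {\<one>\<^bsub>G\<^esub>}}"

definition chief_series :: "('a, 'b) monoid_scheme \<Rightarrow> (nat \<Rightarrow> 'a set) \<Rightarrow> nat \<Rightarrow> bool" where
  "chief_series G N d \<longleftrightarrow>
     (\<forall>i\<le>d. N i \<lhd> G) \<and> N 0 = {\<one>\<^bsub>G\<^esub>} \<and> N d = carrier G \<and>
     (\<forall>i<d. N i \<subset> N (Suc i)) \<and>
     (\<forall>i<d. \<not> (\<exists>M. M \<lhd> G \<and> N i \<subset> M \<and> M \<subset> N (Suc i)))"

text \<open>d(G): length of a chief series (all chief series have the same length by
  Jordan--Hoelder; we take the least), and infinity if there is none.\<close>

definition chief_length :: "('a, 'b) monoid_scheme \<Rightarrow> enat" where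
  "chief_length G =
     (if \<exists>N d. chief_series G N d then enat (LEAST d. \<exists>N. chief_series G N d) else \<infinity>)"

definition is_chain_in :: "('b \<Rightarrow> 'b \<Rightarrow> bool) \<Rightarrow> 'b set \<Rightarrow> bool" where
  "is_chain_in rel C \<longleftrightarrow> (\<forall>x\<in>C. \<forall>y\<in>C. rel x y \<or> rel y x)"

definition realization_points :: "'b set \<Rightarrow> ('b \<Rightarrow> 'b \<Rightarrow> bool) \<Rightarrow> ('b \<Rightarrow> real) set" where
  "realization_points P rel =
     {a. (\<forall>x. 0 \<le> a x) \<and> {x. a x \<noteq> 0} \<subseteq> P \<and> finite {x. a x \<noteq> 0} \<and>
         is_chain_in rel {x. a x \<noteq> 0} \<and> (\<Sum>x\<in>{x. a x \<noteq> 0}. a x) = 1}"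

definition realization_simplex :: "'b set \<Rightarrow> ('b \<Rightarrow> 'b \<Rightarrow> bool) \<Rightarrow> 'b set \<Rightarrow> ('b \<Rightarrow> real) set" where
  "realization_simplex P rel C = {a \<in> realization_points P rel. {x. a x \<noteq> 0} \<subseteq> C}"

definition realization_open :: "'b set \<Rightarrow> ('b \<Rightarrow> 'b \<Rightarrow> bool) \<Rightarrow> ('b \<Rightarrow> real) set \<Rightarrow> bool" where
  "realization_open P rel U \<longleftrightarrow>
     U \<subseteq> realization_points P rel \<and>
     (\<forall>C. finite C \<and> C \<subseteq> P \<and> is_chain_in rel C \<longrightarrow>
        openin (subtopology (powertop_real UNIV) (realization_simplex P rel C))
               (U \<inter> realization_simplex P rel C))"

lemma istopology_realization_open: "istopology (realization_open P rel)"
  unfolding istopology_def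
proof (intro conjI allI impI)
  fix S T assume S: "realization_open P rel S" and T: "realization_open P rel T"
  show "realization_open P rel (S \<inter> T)"
    unfolding realization_open_def
  proof (intro conjI allI impI)
    show "S \<inter> T \<subseteq> realization_points P rel"
      using S unfolding realization_open_def by blast
  next
    fix C assume C: "finite C \<and> C \<subseteq> P \<and> is_chain_in rel C"
    let ?X = "subtopology (powertop_real UNIV) (realization_simplex P rel C)"
    let ?D = "realization_simplex P rel C"
    have 1: "openin ?X (S \<inter> ?D)" using S C unfolding realization_open_def by blast
    have 2: "openin ?X (T \<inter> ?D)" using T C unfolding realization_open_def by blast
    have 3: "S \<inter> T \<inter> ?D = (S \<inter> ?D) \<inter> (T \<inter> ?D)" by blast
    show "openin ?X (S \<inter> T \<inter> ?D)"
      unfolding 3 by (rule openin_Int[OF 1 2])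
  qed
next
  fix K assume K: "\<forall>S\<in>K. realization_open P rel S"
  show "realization_open P rel (\<Union>K)"
    unfolding realization_open_def
  proof (intro conjI allI impI)
    show "\<Union>K \<subseteq> realization_points P rel" using K unfolding realization_open_def by blast
  next
    fix C assume C: "finite C \<and> C \<subseteq> P \<and> is_chain_in rel C"
    let ?X = "subtopology (powertop_real UNIV) (realization_simplex P rel C)"
    let ?D = "realization_simplex P rel C"
    have e: "\<Union>K \<inter> ?D = \<Union>((\<lambda>S. S \<inter> ?D) ` K)" by blast
    have "openin ?X (S \<inter> ?D)" if "S \<in> K" for S
      using K C that unfolding realization_open_def by blast
    then have "openin ?X (\<Union>((\<lambda>S. S \<inter> ?D) ` K))"
      by (intro openin_Union) blast
    then show "openin ?X (\<Union>K \<inter> ?D)" unfolding e .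
  qed
qed

text \<open>The geometric realization |P| carries the coherent (weak) topology with respect
  to its closed simplices, each with its Euclidean topology.\<close>

definition order_complex_realization :: "'b set \<Rightarrow> ('b \<Rightarrow> 'b \<Rightarrow> bool) \<Rightarrow> ('b \<Rightarrow> real) topology" where
  "order_complex_realization P rel = topology (realization_open P rel)"

text \<open>T is n-connected: nonempty if n \<ge> -1, and every map from S^k, 0 \<le> k \<le> n,
  is null-homotopic. For n \<le> -2 this holds vacuously.\<close>

definition n_connected_space :: "int \<Rightarrow> 'a topology \<Rightarrow> bool" where
  "n_connected_space n T \<longleftrightarrow>
     (0 \<le> n + 1 \<longrightarrow> topspace T \<noteq> {}) \<and>
     (\<forall>k::nat. of_nat k \<le> n \<longrightarrow>
        (\<forall>f. continuous_map (nsphere k) T f \<longrightarrow>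
             (\<exists>c. homotopic_with (\<lambda>_. True) (nsphere k) T f (\<lambda>_. c))))"

end

(* Think of a point of |L(G)| as a weight on subgroups, supported on a chain. An arbitrary finitely
   supported weight z gives the function g |-> (sum of z H over H containing g) on G; its
   superlevel sets generate a decreasing family of subgroups, and the lengths of the level intervals
   form a weight on a chain again, as soon as not only the trivial subgroups occur. This
   retraction turns straight lines between weights into homotopies in |L(G)|; the line from a
   to b is admissible when no subgroup in the support of a is a complement of one in the support of b.

   By Dedekind's law a subgroup is a complement of at most one member of a chain (N i) of normal
   subgroups. Hence it suffices to deform a map f into |L(G)| so that every value avoids the
   complements of some N i: it can then be moved into the contractible simplex spanned by the N i.
   If the chain is infinite, this can be done for the identity map of |L(G)|. If the chain has
   m >= k + 2 members and f is defined on the k-sphere, the masses that f x puts on the complements of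
   the N i form a map into R^m, which can be pushed into the boundary of the positive orthant
   because its directions, after a Lipschitz approximation, miss a point. *)

theory Submission
  imports Defs
begin

section \<open>The realization of an order complex\<close>

text \<open>Complements are the only obstruction for the following reason. Let \<open>L\<close> be
  the least member of the first chain and \<open>U\<close> the greatest member of the second. Unless
  \<open>L \<inter> U\<close> is trivial and \<open>L \<union> U\<close> generates \<open>G\<close>,
  an interval of levels of positive length consists of proper nontrivial subgroups at each inner
  point of the line. Complements are removed from the values of a map by rescaling its own weights,
  which never leaves a simplex. What remains is to choose the scaling factors continuously without
  killing all weights at once. On a sphere this is a question of dimension: directions in R^m form a
  space of dimension m - 1, which exceeds k when m is at least k + 2. A merely continuous map can
  fill that space, hence the Lipschitz approximation. A chief series of length d has d - 1 proper
  nontrivial terms, which gives the bound k \<le> d - 3. For an infinite chain each point has finite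
  support, so almost all N i are free of complements there; but no index serves all points, and the
  choice has to vary continuously. The coherent topology is handled by finiteness: compact sources
  meet finitely many vertices, and other homotopies are tested on simplices.\<close>

lemma openin_order_complex_realization:
  "openin (order_complex_realization P rel) U \<longleftrightarrow> realization_open P rel U"
  unfolding order_complex_realization_def
  by (simp add: istopology_realization_open topology_inverse')

lemma realization_simplex_subset: "realization_simplex P rel C \<subseteq> realization_points P rel"
  by (auto simp: realization_simplex_def)

lemma topspace_order_complex_realization [simp]:
  "topspace (order_complex_realization P rel) = realization_points P rel"
proof -
  have "openin (subtopology (powertop_real UNIV) (realization_simplex P rel C))
      (realization_points P rel \<inter> realization_simplex P rel C)" for C
    using openin_topspace[of "subtopology (powertop_real UNIV) (realization_simplex P rel C)"]
    by (simp add: Int_absorb1 realization_simplex_subset)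
  then have "realization_open P rel (realization_points P rel)"
    by (simp add: realization_open_def)
  then show ?thesis
    unfolding topspace_def openin_order_complex_realization
    by (auto simp: realization_open_def)
qed

lemma realization_points_memD:
  assumes "a \<in> realization_points P rel"
  shows "0 \<le> a x" "{x. a x \<noteq> 0} \<subseteq> P" "finite {x. a x \<noteq> 0}"
    "is_chain_in rel {x. a x \<noteq> 0}" "(\<Sum>x\<in>{x. a x \<noteq> 0}. a x) = 1"
  using assms by (auto simp: realization_points_def)

lemma is_chain_in_subset: "is_chain_in rel C \<Longrightarrow> D \<subseteq> C \<Longrightarrow> is_chain_in rel D"
  by (auto simp: is_chain_in_def)

lemma realization_simplex_altdef:
  assumes "finite C" "C \<subseteq> P" "is_chain_in rel C"
  shows "realization_simplex P rel C =
    {a. (\<forall>x. 0 \<le> a x) \<and> (\<forall>x. x \<notin> C \<longrightarrow> a x = 0) \<and> (\<Sum>x\<in>C. a x) = 1}"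
proof -
  have eq: "(\<Sum>x\<in>C. a x) = (\<Sum>x\<in>{x. a x \<noteq> 0}. a x)" if "\<forall>x. x \<notin> C \<longrightarrow> a x = 0" for a :: "'a \<Rightarrow> real"
    using that assms(1) by (intro sum.mono_neutral_right) auto
  have "a \<in> realization_points P rel"
    if "\<forall>x. 0 \<le> a x" "\<forall>x. x \<notin> C \<longrightarrow> a x = 0" "(\<Sum>x\<in>C. a x) = 1" for a
  proof -
    have sub: "{x. a x \<noteq> 0} \<subseteq> C" using that by auto
    then show ?thesis
      using that assms eq[of a] finite_subset[OF sub] is_chain_in_subset[OF assms(3) sub]
      by (auto simp: realization_points_def)
  qed
  moreover have "(\<Sum>x\<in>C. a x) = 1"
    if "a \<in> realization_points P rel" "\<forall>x. x \<notin> C \<longrightarrow> a x = 0" for a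
    using realization_points_memD(5)[OF that(1)] eq[OF that(2)] by simp
  moreover have "{x. a x \<noteq> 0} \<subseteq> C \<longleftrightarrow> (\<forall>x. x \<notin> C \<longrightarrow> a x = 0)" for a :: "'a \<Rightarrow> real"
    by blast
  ultimately show ?thesis
    unfolding realization_simplex_def
    by (intro Collect_cong) (use realization_points_memD(1)[of _ P rel] in blast)
qed

lemma closed_realization_simplex:
  assumes "finite C" "C \<subseteq> P" "is_chain_in rel C"
  shows "closedin (powertop_real UNIV) (realization_simplex P rel C)"
proof -
  have cc: "continuous_on UNIV (\<lambda>a::'a \<Rightarrow> real. a x)" for x
    by (rule continuous_on_product_then_coordinatewise) (rule continuous_on_id)
  have "closed {a::'a \<Rightarrow> real. (\<forall>x. 0 \<le> a x) \<and> (\<forall>x. x \<notin> C \<longrightarrow> a x = 0) \<and> (\<Sum>x\<in>C. a x) = 1}"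
    by (intro closed_Collect_conj closed_Collect_all closed_Collect_imp closed_Collect_le
        closed_Collect_eq continuous_intros cc) auto
  then show ?thesis
    unfolding realization_simplex_altdef[OF assms] euclidean_product_topology
    by simp
qed

section \<open>Maps that use finitely many vertices\<close>

definition finitary_map ::
  "'x topology \<Rightarrow> 'b set \<Rightarrow> ('b \<Rightarrow> 'b \<Rightarrow> bool) \<Rightarrow> ('x \<Rightarrow> 'b \<Rightarrow> real) \<Rightarrow> bool" where
  "finitary_map T P rel f \<longleftrightarrow>
     (\<forall>x\<in>topspace T. f x \<in> realization_points P rel) \<and>
     (\<exists>F. finite F \<and> (\<forall>x\<in>topspace T. {v. f x v \<noteq> 0} \<subseteq> F)) \<and>
     continuous_map T (powertop_real UNIV) f"

text \<open>With finitely many vertices only finitely many simplices occur. Each is closed in the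
  product topology, so the preimage of a closed set is a finite union of closed sets, and
  coordinatewise continuity suffices for the coherent topology.\<close>

lemma finitary_map_imp_continuous_map:
  assumes "finitary_map T P rel f"
  shows "continuous_map T (order_complex_realization P rel) f"
proof -
  let ?R = "order_complex_realization P rel"
  obtain F where F: "finite F" "\<And>x. x \<in> topspace T \<Longrightarrow> {v. f x v \<noteq> 0} \<subseteq> F"
    and pt: "\<And>x. x \<in> topspace T \<Longrightarrow> f x \<in> realization_points P rel"
    and co: "\<And>v. continuous_map T euclideanreal (\<lambda>x. f x v)"
    using assms unfolding finitary_map_def continuous_map_componentwise_UNIV by auto
  have cont: "continuous_map T (powertop_real UNIV) f"
    by (simp add: continuous_map_componentwise_UNIV co)
  define \<C> where "\<C> = {C. C \<subseteq> F \<and> C \<subseteq> P \<and> is_chain_in rel C}"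
  have fin: "finite \<C>" unfolding \<C>_def using F(1) by simp
  show ?thesis
    unfolding continuous_map_closedin
  proof (intro conjI allI impI)
    show "f \<in> topspace T \<rightarrow> topspace ?R" using pt by simp
  next
    fix A assume A: "closedin ?R A"
    have cl: "closedin (powertop_real UNIV) (A \<inter> realization_simplex P rel C)" if "C \<in> \<C>" for C
    proof -
      have C: "finite C" "C \<subseteq> P" "is_chain_in rel C"
        using that F(1) finite_subset unfolding \<C>_def by auto
      let ?S = "realization_simplex P rel C"
      have "realization_open P rel (realization_points P rel - A)"
        using A by (simp add: closedin_def openin_order_complex_realization)
      then have "openin (subtopology (powertop_real UNIV) ?S) ((realization_points P rel - A) \<inter> ?S)"
        using C unfolding realization_open_def by blast
      moreover have "(realization_points P rel - A) \<inter> ?S = ?S - A \<inter> ?S"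
        using realization_simplex_subset by auto
      ultimately have "closedin (subtopology (powertop_real UNIV) ?S) (A \<inter> ?S)"
        by (simp add: closedin_def)
      then show ?thesis
        using closed_realization_simplex[OF C] closedin_trans_full by blast
    qed
    have "{x \<in> topspace T. f x \<in> A} =
        (\<Union>C\<in>\<C>. {x \<in> topspace T. f x \<in> A \<inter> realization_simplex P rel C})"
    proof (intro equalityI subsetI)
      fix x assume x: "x \<in> {x \<in> topspace T. f x \<in> A}"
      then have "{v. f x v \<noteq> 0} \<in> \<C>" "f x \<in> realization_simplex P rel {v. f x v \<noteq> 0}"
        using F(2)[of x] pt[of x] realization_points_memD[OF pt[of x]]
        unfolding \<C>_def realization_simplex_def by auto
      then show "x \<in> (\<Union>C\<in>\<C>. {x \<in> topspace T. f x \<in> A \<inter> realization_simplex P rel C})"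
        using x by blast
    qed auto
    then show "closedin T {x \<in> topspace T. f x \<in> A}"
      using fin closedin_continuous_map_preimage[OF cont cl]
      by (simp only:) (rule closedin_Union; blast)
  qed
qed

text \<open>The coefficients are arbitrary, even unbounded, because the coherent topology tests
  continuity on one simplex at a time. An indicator gives the coordinates; rapidly growing
  coefficients give the compactness argument below.\<close>

lemma continuous_map_linear_functional:
  fixes P :: "'b set" and c :: "'b \<Rightarrow> real"
  shows "continuous_map (order_complex_realization P rel) euclideanreal
           (\<lambda>a. \<Sum>x\<in>{x. a x \<noteq> 0}. c x * a x)"
  unfolding continuous_map_def
proof (intro conjI allI impI)
  let ?h = "\<lambda>a::'b \<Rightarrow> real. \<Sum>x\<in>{x. a x \<noteq> 0}. c x * a x"
  show "?h \<in> topspace (order_complex_realization P rel) \<rightarrow> topspace euclideanreal" by simp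
  fix U :: "real set" assume U: "openin euclideanreal U"
  have "openin (subtopology (powertop_real UNIV) (realization_simplex P rel C))
          ({a \<in> realization_points P rel. ?h a \<in> U} \<inter> realization_simplex P rel C)"
    if C: "finite C" "C \<subseteq> P" "is_chain_in rel C" for C
  proof -
    let ?T = "subtopology (powertop_real UNIV) (realization_simplex P rel C)"
    have "continuous_map ?T euclideanreal (\<lambda>a. \<Sum>x\<in>C. c x * a x)"
      using C(1) by (intro continuous_map_sum continuous_map_real_mult
          continuous_map_from_subtopology continuous_map_product_projection) auto
    moreover have "(\<Sum>x\<in>C. c x * a x) = ?h a" if "a \<in> realization_simplex P rel C" for a
      using that C(1) unfolding realization_simplex_def
      by (intro sum.mono_neutral_right) auto
    ultimately have "continuous_map ?T euclideanreal ?h"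
      by (rule continuous_map_eq) simp
    then have "openin ?T {a \<in> topspace ?T. ?h a \<in> U}"
      using U by (rule openin_continuous_map_preimage)
    moreover have "{a \<in> topspace ?T. ?h a \<in> U} =
        {a \<in> realization_points P rel. ?h a \<in> U} \<inter> realization_simplex P rel C"
      using realization_simplex_subset by auto
    ultimately show ?thesis by simp
  qed
  then show "openin (order_complex_realization P rel)
      {a \<in> topspace (order_complex_realization P rel). ?h a \<in> U}"
    by (auto simp: openin_order_complex_realization realization_open_def)
qed

lemma continuous_map_coordinate:
  "continuous_map (order_complex_realization P rel) euclideanreal (\<lambda>a. a v)"
proof (rule continuous_map_eq[OF continuous_map_linear_functional])
  fix a assume "a \<in> topspace (order_complex_realization P rel)"
  then have "finite {x. a x \<noteq> 0}" by (auto simp: realization_points_def)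
  then show "(\<Sum>x\<in>{x. a x \<noteq> 0}. (if x = v then 1 else 0) * a x) = a v"
    by (simp add: if_distrib[where f = "\<lambda>y. y * _"] sum.delta cong: if_cong)
qed

text \<open>If infinitely many vertices occurred, a linear functional with rapidly growing
  coefficients would be unbounded on the compact image.\<close>

lemma compact_continuous_imp_finitary_map:
  assumes T: "compact_space T" and f: "continuous_map T (order_complex_realization P rel) f"
  shows "finitary_map T P rel f"
proof -
  have pt: "f x \<in> realization_points P rel" if "x \<in> topspace T" for x
    using continuous_map_image_subset_topspace[OF f] that by auto
  define V where "V = (\<Union>x\<in>topspace T. {v. f x v \<noteq> 0})"
  have "finite V"
  proof (rule ccontr)
    assume "infinite V"
    then obtain w :: "nat \<Rightarrow> 'b" where w: "inj w" "range w \<subseteq> V"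
      by (meson infinite_countable_subset)
    then have "\<forall>n. \<exists>x. x \<in> topspace T \<and> f x (w n) \<noteq> 0"
      unfolding V_def by blast
    then obtain p where p: "\<And>n. p n \<in> topspace T" "\<And>n. f (p n) (w n) \<noteq> 0"
      by metis
    \<comment> \<open>The coefficient is chosen so that the vertex \<open>w n\<close> alone
      contributes exactly \<open>n\<close> to the functional at the point
      \<open>f (p n)\<close>.\<close>
    define c where "c v = (if v \<in> range w then real (the_inv w v) / f (p (the_inv w v)) v else 0)" for v
    have cw: "c (w n) = real n / f (p n) (w n)" for n
      using w(1) by (simp add: c_def the_inv_f_f)
    have c0: "0 \<le> c v" for v
      using realization_points_memD(1)[OF pt[OF p(1)]] by (auto simp: c_def)
    define h where "h a = (\<Sum>x\<in>{x. a x \<noteq> 0}. c x * a x)" for a :: "'b \<Rightarrow> real"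
    have "continuous_map T euclideanreal (h \<circ> f)"
      unfolding h_def by (rule continuous_map_compose[OF f continuous_map_linear_functional])
    then have "compact ((h \<circ> f) ` topspace T)"
      using T image_compactin compact_space_def by (metis compactin_euclidean_iff)
    then have "bdd_above ((h \<circ> f) ` topspace T)"
      by (intro bounded_imp_bdd_above compact_imp_bounded)
    then obtain B where B: "\<And>x. x \<in> topspace T \<Longrightarrow> h (f x) \<le> B"
      unfolding bdd_above_def by auto
    have "real n \<le> B" for n
    proof -
      have fin: "finite {x. f (p n) x \<noteq> 0}" using realization_points_memD(3)[OF pt[OF p(1)]] .
      have "real n = c (w n) * f (p n) (w n)" using p(2)[of n] by (simp add: cw)
      also have "\<dots> \<le> h (f (p n))"
        unfolding h_def using fin p(2) c0 realization_points_memD(1)[OF pt[OF p(1)]]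
        by (intro member_le_sum[where f = "\<lambda>x. c x * f (p n) x"]) auto
      also have "\<dots> \<le> B" using B p(1) by blast
      finally show ?thesis .
    qed
    then show False using reals_Archimedean2[of B] by (meson not_le)
  qed
  moreover have "continuous_map T euclideanreal (\<lambda>x. f x v)" for v
    using continuous_map_compose[OF f continuous_map_coordinate[of P rel v]] by (simp add: o_def)
  ultimately show ?thesis
    unfolding finitary_map_def continuous_map_componentwise_UNIV using pt
    by (auto simp: V_def intro!: exI[of _ V])
qed

section \<open>The realization as a quotient, and maps out of products with it\<close>

lemma quotient_map_realization:
  fixes P :: "'b set" and rel :: "'b \<Rightarrow> 'b \<Rightarrow> bool"
  defines "\<C> \<equiv> {C. finite C \<and> C \<subseteq> P \<and> is_chain_in rel C}"
  shows "quotient_map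
    (sum_topology (\<lambda>C. subtopology (powertop_real UNIV) (realization_simplex P rel C)) \<C>)
    (order_complex_realization P rel) snd"
  unfolding quotient_map_def
proof (intro conjI allI impI)
  let ?S = "sum_topology (\<lambda>C. subtopology (powertop_real UNIV) (realization_simplex P rel C)) \<C>"
  have top: "topspace ?S = Sigma \<C> (realization_simplex P rel)"
    by (auto simp: Sigma_def)
  show "snd ` topspace ?S = topspace (order_complex_realization P rel)"
  proof
    show "snd ` topspace ?S \<subseteq> topspace (order_complex_realization P rel)"
      unfolding top using realization_simplex_subset by fastforce
    show "topspace (order_complex_realization P rel) \<subseteq> snd ` topspace ?S"
    proof
      fix a assume a: "a \<in> topspace (order_complex_realization P rel)"
      then have "({x. a x \<noteq> 0}, a) \<in> topspace ?S"
        unfolding top \<C>_def by (auto simp: realization_points_def realization_simplex_def)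
      then show "a \<in> snd ` topspace ?S" by force
    qed
  qed
  fix U assume U: "U \<subseteq> topspace (order_complex_realization P rel)"
  have "{x. (C, x) \<in> {x \<in> topspace ?S. snd x \<in> U}} = U \<inter> realization_simplex P rel C"
    if "C \<in> \<C>" for C using that unfolding top by auto
  then show "openin ?S {x \<in> topspace ?S. snd x \<in> U} =
      openin (order_complex_realization P rel) U"
    using U unfolding openin_sum_topology openin_order_complex_realization realization_open_def
    by (auto simp: \<C>_def)
qed

lemma continuous_map_prod_sum_topology:
  assumes "\<And>i. i \<in> I \<Longrightarrow> continuous_map (prod_topology Z (T i)) Y (\<lambda>(z, x). h (z, i, x))"
  shows "continuous_map (prod_topology Z (sum_topology T I)) Y h"
  unfolding continuous_map_def
proof (intro conjI allI impI)
  show "h \<in> topspace (prod_topology Z (sum_topology T I)) \<rightarrow> topspace Y"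
    using continuous_map_image_subset_topspace[OF assms] by fastforce
  fix U assume U: "openin Y U"
  let ?W = "{q \<in> topspace (prod_topology Z (sum_topology T I)). h q \<in> U}"
  show "openin (prod_topology Z (sum_topology T I)) ?W"
    unfolding openin_prod_topology_alt
  proof (intro allI impI)
    fix z p assume zp: "(z, p) \<in> ?W"
    obtain i x where p: "p = (i, x)" by force
    have i: "i \<in> I" using zp p by auto
    have op: "openin (prod_topology Z (T i))
        {q \<in> topspace (prod_topology Z (T i)). (\<lambda>(z, x). h (z, i, x)) q \<in> U}"
      using openin_continuous_map_preimage[OF assms[OF i] U] .
    have "(z, x) \<in> {q \<in> topspace (prod_topology Z (T i)). (\<lambda>(z, x). h (z, i, x)) q \<in> U}"
      using zp p by auto
    then obtain A B where AB: "openin Z A" "openin (T i) B" "z \<in> A" "x \<in> B"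
        "A \<times> B \<subseteq> {q \<in> topspace (prod_topology Z (T i)). (\<lambda>(z, x). h (z, i, x)) q \<in> U}"
      using op[unfolded openin_prod_topology_alt, rule_format] by meson
    have "openin (sum_topology T I) ({i} \<times> B)"
      unfolding openin_sum_topology
    proof (intro conjI ballI)
      show "{i} \<times> B \<subseteq> Sigma I (topspace \<circ> T)" using i openin_subset[OF AB(2)] by auto
      fix j assume "j \<in> I"
      have "{x. (j, x) \<in> {i} \<times> B} = (if j = i then B else {})" by auto
      then show "openin (T j) {x. (j, x) \<in> {i} \<times> B}" using AB(2) by simp
    qed
    moreover have "A \<times> ({i} \<times> B) \<subseteq> ?W"
    proof
      fix q assume "q \<in> A \<times> ({i} \<times> B)"
      then obtain z' x' where q: "q = (z', i, x')" "(z', x') \<in> A \<times> B" by auto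
      then have "(z', x') \<in> topspace (prod_topology Z (T i))" "h (z', i, x') \<in> U"
        using AB(5) by auto
      then show "q \<in> ?W" using q(1) i by auto
    qed
    moreover have "p \<in> {i} \<times> B" using AB(4) p by simp
    ultimately show "\<exists>A B. openin Z A \<and> openin (sum_topology T I) B \<and> z \<in> A \<and> p \<in> B \<and> A \<times> B \<subseteq> ?W"
      using AB(1,3) by blast
  qed
qed

text \<open>A homotopy lives on a product, whereas the coherent topology only controls maps out of
  the realization itself. For locally compact Hausdorff \<open>Z\<close> the product of the quotient
  map with the identity of \<open>Z\<close> is again a quotient map, so continuity may be tested
  simplex by simplex.\<close>

lemma continuous_map_prod_realization:
  fixes P :: "'b set"
  assumes Z: "locally_compact_space Z" "Hausdorff_space Z"
    and h: "\<And>C. finite C \<Longrightarrow> C \<subseteq> P \<Longrightarrow> is_chain_in rel C \<Longrightarrow>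
      continuous_map (prod_topology Z (subtopology (powertop_real UNIV) (realization_simplex P rel C)))
        Y (\<lambda>(t, a). h (t, a))"
  shows "continuous_map (prod_topology Z (order_complex_realization P rel)) Y h"
proof (rule continuous_compose_quotient_map)
  let ?\<C> = "{C. finite C \<and> C \<subseteq> P \<and> is_chain_in rel C}"
  let ?S = "sum_topology (\<lambda>C. subtopology (powertop_real UNIV) (realization_simplex P rel C)) ?\<C>"
  show "quotient_map (prod_topology Z ?S) (prod_topology Z (order_complex_realization P rel))
      (\<lambda>(z, x). (z, snd x))"
    using Z by (intro quotient_map_prod_right quotient_map_realization) auto
  show "continuous_map (prod_topology Z ?S) Y (h \<circ> (\<lambda>(z, x). (z, snd x)))"
    using h by (intro continuous_map_prod_sum_topology) (auto simp: case_prod_unfold)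
qed

section \<open>Level subgroups of a weighted family of subgroups\<close>

definition level_subgroup :: "('a, 'b) monoid_scheme \<Rightarrow> ('a set \<Rightarrow> real) \<Rightarrow> real \<Rightarrow> 'a set" where
  "level_subgroup G z s = generate G {g \<in> carrier G. s \<le> (\<Sum>H | z H \<noteq> 0 \<and> g \<in> H. z H)}"

text \<open>Only levels in (0,1] count: the weights in question are nonnegative of total mass 1, so
  the function on the group has values in [0,1]. Levels at most 0 give the whole group, levels above
  1 the trivial subgroup.\<close>

definition level_measure ::
  "('a, 'b) monoid_scheme \<Rightarrow> ('a set \<Rightarrow> real) \<Rightarrow> ('a set \<Rightarrow> bool) \<Rightarrow> real" where
  "level_measure G z Q = measure lborel {s \<in> {0<..1}. Q (level_subgroup G z s)}"

text \<open>Levels whose subgroup is trivial or the whole group are discarded and the rest is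
  rescaled to mass 1. If nothing is left, division by zero yields the zero function, which is not a
  point; \<open>mixable\<close> excludes this along a line.\<close>

definition level_chain :: "('a, 'b) monoid_scheme \<Rightarrow> ('a set \<Rightarrow> real) \<Rightarrow> 'a set \<Rightarrow> real" where
  "level_chain G z K =
     (if K \<in> proper_nontrivial_subgroups G
      then level_measure G z (\<lambda>L. L = K) / level_measure G z (\<lambda>L. L \<in> proper_nontrivial_subgroups G)
      else 0)"

text \<open>The level \<open>s\<close> enters only through the set of those subsets of
  \<open>F\<close> whose weight reaches \<open>s\<close>. So finitely many subgroups can occur, from
  a list that depends on \<open>F\<close> but not on \<open>z\<close>; measurability, the Lipschitz
  bound and the finiteness of supports all rest on this.\<close>

lemma level_subgroup_eq:
  assumes "finite F" "{H. z H \<noteq> 0} \<subseteq> F"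
  shows "level_subgroup G z s =
    generate G {g \<in> carrier G. {H \<in> F. g \<in> H} \<in> {S \<in> Pow F. s \<le> sum z S}}"
proof -
  have "(\<Sum>H | z H \<noteq> 0 \<and> g \<in> H. z H) = sum z {H \<in> F. g \<in> H}" for g
    using assms by (intro sum.mono_neutral_left) auto
  then show ?thesis by (simp add: level_subgroup_def)
qed

lemma level_subgroup_antimono:
  assumes "group G" "s \<le> t"
  shows "level_subgroup G z t \<subseteq> level_subgroup G z s"
  unfolding level_subgroup_def using assms by (intro group.mono_generate) auto

lemma level_subgroup_is_subgroup:
  assumes "group G" shows "subgroup (level_subgroup G z s) G"
  unfolding level_subgroup_def using assms by (intro group.generate_is_subgroup) auto

text \<open>By the finite description of the level subgroups, the set is a finite union of finite
  intersections of half-lines with (0,1].\<close>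

lemma level_set_fmeasurable:
  assumes "finite F" "{H. z H \<noteq> 0} \<subseteq> F"
  shows "{s \<in> {0<..1}. Q (level_subgroup G z s)} \<in> fmeasurable lborel"
proof -
  define gen where "gen W = generate G {g \<in> carrier G. {H \<in> F. g \<in> H} \<in> W}" for W
  define \<W> where "\<W> = {W \<in> Pow (Pow F). Q (gen W)}"
  have "{s \<in> {0<..1}. Q (level_subgroup G z s)} =
      (\<Union>W\<in>\<W>. {0<..1} \<inter> (\<Inter>S\<in>Pow F. {s. s \<le> sum z S \<longleftrightarrow> S \<in> W}))"
  proof (intro equalityI subsetI)
    fix s assume s: "s \<in> {s \<in> {0<..1}. Q (level_subgroup G z s)}"
    then have "{S \<in> Pow F. s \<le> sum z S} \<in> \<W>"
      unfolding \<W>_def gen_def level_subgroup_eq[OF assms] by auto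
    then show "s \<in> (\<Union>W\<in>\<W>. {0<..1} \<inter> (\<Inter>S\<in>Pow F. {s. s \<le> sum z S \<longleftrightarrow> S \<in> W}))"
      using s by (intro UN_I) auto
  next
    fix s assume "s \<in> (\<Union>W\<in>\<W>. {0<..1} \<inter> (\<Inter>S\<in>Pow F. {s. s \<le> sum z S \<longleftrightarrow> S \<in> W}))"
    then obtain W where W: "W \<in> \<W>" "s \<in> {0<..1}" "\<And>S. S \<in> Pow F \<Longrightarrow> s \<le> sum z S \<longleftrightarrow> S \<in> W"
      by auto
    then have "W = {S \<in> Pow F. s \<le> sum z S}" unfolding \<W>_def by auto
    then show "s \<in> {s \<in> {0<..1}. Q (level_subgroup G z s)}"
      using W(1,2) unfolding \<W>_def gen_def level_subgroup_eq[OF assms] by auto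
  qed
  moreover have "{s. s \<le> sum z S \<longleftrightarrow> S \<in> W} \<in> sets lborel" for S W
    by (cases "S \<in> W") auto
  then have "(\<Inter>S\<in>Pow F. {s. s \<le> sum z S \<longleftrightarrow> S \<in> W}) \<in> sets lborel" for W
    using assms(1) by (intro sets.finite_INT) auto
  then have "{0<..1} \<inter> (\<Inter>S\<in>Pow F. {s. s \<le> sum z S \<longleftrightarrow> S \<in> W}) \<in> sets lborel" for W
    by (intro sets.Int) simp_all
  moreover have "finite \<W>" using assms(1) unfolding \<W>_def by auto
  ultimately have "{s \<in> {0<..1}. Q (level_subgroup G z s)} \<in> sets lborel"
    by (simp only: sets.finite_UN)
  moreover have "{0<..1::real} \<in> fmeasurable lborel" by (simp add: fmeasurable_def)
  ultimately show ?thesis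
    using fmeasurableI2[of "{0<..1::real}" lborel "{s \<in> {0<..1}. Q (level_subgroup G z s)}"] by blast
qed

lemma level_measure_mono:
  assumes "finite {H. z H \<noteq> 0}"
    and "\<And>s. s \<in> {0<..1} \<Longrightarrow> Q (level_subgroup G z s) \<Longrightarrow> R (level_subgroup G z s)"
  shows "level_measure G z Q \<le> level_measure G z R"
  unfolding level_measure_def
  by (rule measure_mono_fmeasurable[OF _ fmeasurableD level_set_fmeasurable])
    (use assms level_set_fmeasurable[OF assms(1) order_refl] in auto)

lemma level_measure_ge_interval:
  assumes "finite {H. z H \<noteq> 0}" "0 \<le> a" "a \<le> b" "b \<le> 1"
    and "\<And>s. s \<in> {a<..b} \<Longrightarrow> Q (level_subgroup G z s)"
  shows "b - a \<le> level_measure G z Q"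
proof -
  have "measure lborel {a<..b} \<le> level_measure G z Q"
    unfolding level_measure_def
    by (rule measure_mono_fmeasurable[OF _ _ level_set_fmeasurable[OF assms(1) order_refl]])
      (use assms in auto)
  then show ?thesis using assms(3) by simp
qed

lemma level_measure_le_1:
  assumes "finite {H. z H \<noteq> 0}"
  shows "level_measure G z Q \<le> 1"
proof -
  have "level_measure G z Q \<le> measure lborel {0<..1::real}"
    unfolding level_measure_def
    by (rule measure_mono_fmeasurable[OF _ fmeasurableD[OF level_set_fmeasurable[OF assms order_refl]]])
      (auto simp: fmeasurable_def)
  then show ?thesis by simp
qed

lemma level_measure_nonneg: "0 \<le> level_measure G z Q"
  by (simp add: level_measure_def)

lemma level_measure_sum:
  assumes "finite {H. z H \<noteq> 0}" "finite \<K>"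
  shows "(\<Sum>K\<in>\<K>. level_measure G z (\<lambda>L. L = K)) = level_measure G z (\<lambda>L. L \<in> \<K>)"
proof -
  let ?A = "\<lambda>K. {s \<in> {0<..1}. level_subgroup G z s = K}"
  have fm: "?A K \<in> fmeasurable lborel" for K
    using level_set_fmeasurable[OF assms(1) order_refl, where Q = "\<lambda>L. L = K"] by simp
  have "measure lborel (\<Union>K\<in>\<K>. ?A K) = (\<Sum>K\<in>\<K>. measure lborel (?A K))"
    using assms(2) fm[THEN fmeasurableD] fm[THEN fmeasurableD2]
    by (intro measure_finite_Union) (auto simp: disjoint_family_on_def)
  moreover have "(\<Union>K\<in>\<K>. ?A K) = {s \<in> {0<..1}. level_subgroup G z s \<in> \<K>}" by auto
  ultimately show ?thesis by (simp only: level_measure_def)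
qed

text \<open>The level subgroups of \<open>z\<close> and \<open>y\<close> at \<open>s\<close> can
  differ only if \<open>s\<close> lies between \<open>sum z S\<close> and \<open>sum y S\<close> for
  some \<open>S\<close>. The total length of these intervals is the error term.\<close>

lemma level_measure_lipschitz:
  assumes F: "finite F" "{H. z H \<noteq> 0} \<subseteq> F" "{H. y H \<noteq> 0} \<subseteq> F"
  shows "level_measure G z Q \<le> level_measure G y Q + (\<Sum>S\<in>Pow F. \<bar>sum z S - sum y S\<bar>)"
proof -
  let ?A = "{s \<in> {0<..1}. Q (level_subgroup G z s)}"
  let ?B = "{s \<in> {0<..1}. Q (level_subgroup G y s)}"
  let ?D = "\<lambda>S. {min (sum z S) (sum y S)..max (sum z S) (sum y S)}"
  have sub: "?A \<subseteq> ?B \<union> (\<Union>S\<in>Pow F. ?D S)"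
  proof
    fix s assume s: "s \<in> ?A"
    show "s \<in> ?B \<union> (\<Union>S\<in>Pow F. ?D S)"
    proof (cases "\<exists>S\<in>Pow F. s \<in> ?D S")
      case False
      then have "s \<le> sum z S \<longleftrightarrow> s \<le> sum y S" if "S \<in> Pow F" for S
      proof -
        have "\<not> (min (sum z S) (sum y S) \<le> s \<and> s \<le> max (sum z S) (sum y S))"
          using False that by (metis atLeastAtMost_iff)
        then show ?thesis by linarith
      qed
      then have "{S \<in> Pow F. s \<le> sum z S} = {S \<in> Pow F. s \<le> sum y S}" by blast
      then have "level_subgroup G z s = level_subgroup G y s"
        by (simp only: level_subgroup_eq[OF F(1,2)] level_subgroup_eq[OF F(1,3)])
      then show ?thesis using s by auto
    qed auto
  qed
  have fA: "?A \<in> fmeasurable lborel" "?B \<in> fmeasurable lborel"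
    using level_set_fmeasurable F by blast+
  have fD: "?D S \<in> fmeasurable lborel" for S by (simp add: fmeasurable_def)
  have fU: "(\<Union>S\<in>Pow F. ?D S) \<in> fmeasurable lborel"
    using F(1) fD by (intro fmeasurable.finite_UN) auto
  have "measure lborel ?A \<le> measure lborel (?B \<union> (\<Union>S\<in>Pow F. ?D S))"
    using sub fA fU by (intro measure_mono_fmeasurable fmeasurable.Un) (auto dest: fmeasurableD)
  also have "\<dots> \<le> measure lborel ?B + measure lborel (\<Union>S\<in>Pow F. ?D S)"
    using fA fU by (intro measure_Un_le) (auto dest: fmeasurableD)
  also have "measure lborel (\<Union>S\<in>Pow F. ?D S) \<le> (\<Sum>S\<in>Pow F. measure lborel (?D S))"
    by (rule measure_UNION_le) (simp_all add: F(1))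
  also have "(\<Sum>S\<in>Pow F. measure lborel (?D S)) = (\<Sum>S\<in>Pow F. \<bar>sum z S - sum y S\<bar>)"
    by (intro sum.cong refl) (simp add: min_def max_def)
  finally show ?thesis unfolding level_measure_def by linarith
qed

lemma continuous_map_level_measure:
  assumes F: "finite F" "\<And>x. x \<in> topspace T \<Longrightarrow> {H. z x H \<noteq> 0} \<subseteq> F"
    and z: "\<And>H. continuous_map T euclideanreal (\<lambda>x. z x H)"
  shows "continuous_map T euclideanreal (\<lambda>x. level_measure G (z x) Q)"
  unfolding continuous_map_atin limitin_canonical_iff
proof
  fix p assume p: "p \<in> topspace T"
  have "((\<lambda>x. z x H) \<longlongrightarrow> z p H) (atin T p)" for H
    using z p unfolding continuous_map_atin limitin_canonical_iff by blast
  then have "((\<lambda>x. \<Sum>S\<in>Pow F. \<bar>sum (z x) S - sum (z p) S\<bar>) \<longlongrightarrow>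
      (\<Sum>S\<in>Pow F. \<bar>sum (z p) S - sum (z p) S\<bar>)) (atin T p)"
    by (intro tendsto_sum tendsto_rabs tendsto_diff tendsto_const)
  then have lim: "((\<lambda>x. \<Sum>S\<in>Pow F. \<bar>sum (z x) S - sum (z p) S\<bar>) \<longlongrightarrow> 0) (atin T p)"
    by simp
  have "norm (level_measure G (z x) Q - level_measure G (z p) Q)
      \<le> (\<Sum>S\<in>Pow F. \<bar>sum (z x) S - sum (z p) S\<bar>)" if "x \<in> topspace T" for x
    using level_measure_lipschitz[OF F(1) F(2)[OF that] F(2)[OF p], of G Q]
      level_measure_lipschitz[OF F(1) F(2)[OF p] F(2)[OF that], of G Q]
    by (simp add: abs_minus_commute abs_le_iff)
  then have "eventually (\<lambda>x. norm (level_measure G (z x) Q - level_measure G (z p) Q)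
      \<le> (\<Sum>S\<in>Pow F. \<bar>sum (z x) S - sum (z p) S\<bar>)) (atin T p)"
    unfolding eventually_atin using p by (auto intro!: exI[of _ "topspace T"])
  then have "((\<lambda>x. level_measure G (z x) Q - level_measure G (z p) Q) \<longlongrightarrow> 0) (atin T p)"
    by (rule Lim_null_comparison[OF _ lim])
  then show "((\<lambda>x. level_measure G (z x) Q) \<longlongrightarrow> level_measure G (z p) Q) (atin T p)"
    by (simp add: LIM_zero_iff)
qed

lemma level_chain_support:
  assumes "finite F" "{H. z H \<noteq> 0} \<subseteq> F"
  shows "{K. level_chain G z K \<noteq> 0} \<subseteq>
    (\<lambda>W. generate G {g \<in> carrier G. {H \<in> F. g \<in> H} \<in> W}) ` Pow (Pow F)"
proof
  fix K assume "K \<in> {K. level_chain G z K \<noteq> 0}"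
  then have "level_measure G z (\<lambda>L. L = K) \<noteq> 0" by (auto simp: level_chain_def split: if_splits)
  then have "{s \<in> {0<..1}. level_subgroup G z s = K} \<noteq> {}"
    unfolding level_measure_def by (metis measure_empty)
  then obtain s where "level_subgroup G z s = K" by auto
  then show "K \<in> (\<lambda>W. generate G {g \<in> carrier G. {H \<in> F. g \<in> H} \<in> W}) ` Pow (Pow F)"
    unfolding level_subgroup_eq[OF assms] by blast
qed

text \<open>The support is a chain because level subgroups decrease as the level grows, whatever the
  weights were.\<close>

lemma level_chain_in_realization:
  assumes "group G" "finite {H. z H \<noteq> 0}"
    and pos: "0 < level_measure G z (\<lambda>L. L \<in> proper_nontrivial_subgroups G)"
  shows "level_chain G z \<in> realization_points (proper_nontrivial_subgroups G) (\<subseteq>)"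
proof -
  let ?P = "proper_nontrivial_subgroups G"
  define \<K> where
    "\<K> = (\<lambda>W. generate G {g \<in> carrier G. {H \<in> {H. z H \<noteq> 0}. g \<in> H} \<in> W}) ` Pow (Pow {H. z H \<noteq> 0})"
  have fin: "finite \<K>" unfolding \<K>_def using assms(2) by simp
  have lev: "level_subgroup G z s \<in> \<K>" for s
    unfolding level_subgroup_eq[OF assms(2) order_refl] \<K>_def by blast
  have supp: "{K. level_chain G z K \<noteq> 0} \<subseteq> \<K> \<inter> ?P"
    using level_chain_support[OF assms(2) order_refl, of G] unfolding \<K>_def
    by (auto simp: level_chain_def split: if_splits)
  have ex: "\<exists>s. level_subgroup G z s = K" if "level_chain G z K \<noteq> 0" for K
  proof -
    have "level_measure G z (\<lambda>L. L = K) \<noteq> 0"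
      using that by (auto simp: level_chain_def split: if_splits)
    then have "{s \<in> {0<..1}. level_subgroup G z s = K} \<noteq> {}"
      unfolding level_measure_def by (metis measure_empty)
    then show ?thesis by auto
  qed
  have "is_chain_in (\<subseteq>) {K. level_chain G z K \<noteq> 0}"
    unfolding is_chain_in_def
  proof (intro ballI)
    fix K L assume "K \<in> {K. level_chain G z K \<noteq> 0}" "L \<in> {K. level_chain G z K \<noteq> 0}"
    then obtain s t where "level_subgroup G z s = K" "level_subgroup G z t = L"
      using ex by blast
    then show "K \<subseteq> L \<or> L \<subseteq> K"
      using level_subgroup_antimono[OF assms(1)] linear[of s t] by blast
  qed
  moreover have "(\<Sum>K\<in>{K. level_chain G z K \<noteq> 0}. level_chain G z K) = 1"
  proof -
    have "(\<Sum>K\<in>{K. level_chain G z K \<noteq> 0}. level_chain G z K) = (\<Sum>K\<in>\<K> \<inter> ?P. level_chain G z K)"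
      using supp fin by (intro sum.mono_neutral_left) auto
    also have "\<dots> = (\<Sum>K\<in>\<K> \<inter> ?P. level_measure G z (\<lambda>L. L = K)) / level_measure G z (\<lambda>L. L \<in> ?P)"
      by (simp add: level_chain_def sum_divide_distrib)
    also have "\<dots> = 1"
    proof -
      have "level_measure G z (\<lambda>L. L \<in> \<K> \<inter> ?P) = level_measure G z (\<lambda>L. L \<in> ?P)"
        using lev by (simp add: level_measure_def)
      then show ?thesis
        using pos level_measure_sum[OF assms(2), of "\<K> \<inter> ?P" G] fin by simp
    qed
    finally show ?thesis .
  qed
  ultimately show ?thesis
    using supp fin finite_subset[OF supp]
    by (auto simp: realization_points_def level_chain_def level_measure_nonneg)
qed

text \<open>Let \<open>b\<close> be the weight of the members strictly above \<open>K\<close>.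
  Levels in the interval from \<open>b\<close> to \<open>z K + b\<close> have superlevel set exactly
  \<open>K\<close>, which bounds the measure of \<open>K\<close> below by \<open>z K\<close>. These
  bounds already add up to 1, the largest possible total, so all of them are equalities.\<close>

lemma level_measure_of_chain:
  assumes G: "group G" and z: "z \<in> realization_points (proper_nontrivial_subgroups G) (\<subseteq>)"
  shows "level_measure G z (\<lambda>L. L = K) = z K"
    and "level_measure G z (\<lambda>L. L \<in> proper_nontrivial_subgroups G) = 1"
proof -
  let ?P = "proper_nontrivial_subgroups G"
  let ?C = "{H. z H \<noteq> 0}"
  note zD = realization_points_memD[OF z]
  have ge: "z K \<le> level_measure G z (\<lambda>L. L = K)" if K: "K \<in> ?C" for K
  proof -
    define b where "b = sum z {H \<in> ?C. K \<subset> H}"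
    have fin: "finite {H \<in> ?C. K \<subset> H}" using zD(3) by simp
    have kb: "z K + b = sum z (insert K {H \<in> ?C. K \<subset> H})"
      using fin unfolding b_def by (subst sum.insert) auto
    also have "\<dots> \<le> sum z ?C" using K zD(1,3) by (intro sum_mono2) auto
    finally have le1: "z K + b \<le> 1" using zD(5) by simp
    have "level_subgroup G z s = K" if s: "s \<in> {b<..z K + b}" for s
    proof -
      have "{g \<in> carrier G. s \<le> (\<Sum>H | z H \<noteq> 0 \<and> g \<in> H. z H)} = K"
      proof (intro equalityI subsetI)
        fix g assume g: "g \<in> {g \<in> carrier G. s \<le> (\<Sum>H | z H \<noteq> 0 \<and> g \<in> H. z H)}"
        show "g \<in> K"
        proof (rule ccontr)
          assume "g \<notin> K"
          then have "{H. z H \<noteq> 0 \<and> g \<in> H} \<subseteq> {H \<in> ?C. K \<subset> H}"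
            using K zD(4) unfolding is_chain_in_def by blast
          then have "(\<Sum>H | z H \<noteq> 0 \<and> g \<in> H. z H) \<le> b"
            unfolding b_def using fin zD(1) by (intro sum_mono2) auto
          then show False using g s by auto
        qed
      next
        fix g assume g: "g \<in> K"
        have "insert K {H \<in> ?C. K \<subset> H} \<subseteq> {H. z H \<noteq> 0 \<and> g \<in> H}" using K g by auto
        then have "z K + b \<le> (\<Sum>H | z H \<noteq> 0 \<and> g \<in> H. z H)"
          unfolding kb using zD(1,3) by (intro sum_mono2) auto
        moreover have "g \<in> carrier G"
          using K g zD(2) subgroup.subset unfolding proper_nontrivial_subgroups_def by blast
        ultimately show "g \<in> {g \<in> carrier G. s \<le> (\<Sum>H | z H \<noteq> 0 \<and> g \<in> H. z H)}" using s by auto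
      qed
      moreover have "generate G K = K"
        using K zD(2) group.generateI[OF G] unfolding proper_nontrivial_subgroups_def by blast
      ultimately show ?thesis by (simp add: level_subgroup_def)
    qed
    moreover have "0 \<le> b" using zD(1) unfolding b_def by (simp add: sum_nonneg)
    ultimately show ?thesis
      using level_measure_ge_interval[OF zD(3), of b "z K + b" "\<lambda>L. L = K" G] le1 zD(1)[of K] by auto
  qed
  have tot: "(\<Sum>K\<in>\<K>. level_measure G z (\<lambda>L. L = K)) \<le> 1" if "finite \<K>" for \<K>
    using level_measure_sum[OF zD(3) that, of G] level_measure_le_1[OF zD(3)] by simp
  have sumC: "(\<Sum>K\<in>?C. level_measure G z (\<lambda>L. L = K)) = 1"
    using tot[OF zD(3)] sum_mono[of ?C z "\<lambda>K. level_measure G z (\<lambda>L. L = K)"] ge zD(5) by fastforce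
  show "level_measure G z (\<lambda>L. L = K) = z K"
  proof (cases "K \<in> ?C")
    case True
    have "(\<Sum>K\<in>?C. level_measure G z (\<lambda>L. L = K) - z K) = 0"
      using sumC zD(5) by (simp add: sum_subtractf)
    then have "\<forall>K\<in>?C. level_measure G z (\<lambda>L. L = K) - z K = 0"
      using ge zD(3) by (subst (asm) sum_nonneg_eq_0_iff) auto
    then show ?thesis using True by simp
  next
    case False
    then show ?thesis
      using tot[of "insert K ?C"] sumC zD(3) level_measure_nonneg[of G z "\<lambda>L. L = K"] by auto
  qed
  have "1 \<le> level_measure G z (\<lambda>L. L \<in> ?P)"
    using level_measure_mono[of z "\<lambda>L. L \<in> ?C" G "\<lambda>L. L \<in> ?P"] zD(2,3)
      level_measure_sum[OF zD(3) zD(3), of G] sumC by auto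
  then show "level_measure G z (\<lambda>L. L \<in> ?P) = 1"
    using level_measure_le_1[OF zD(3), of G "\<lambda>L. L \<in> ?P"] by simp
qed

lemma level_chain_id:
  assumes "group G" "z \<in> realization_points (proper_nontrivial_subgroups G) (\<subseteq>)"
  shows "level_chain G z = z"
  using level_measure_of_chain[OF assms] realization_points_memD(2)[OF assms(2)]
  by (auto simp: level_chain_def fun_eq_iff)

section \<open>Homotopies through level subgroups\<close>

abbreviation mix :: "real \<Rightarrow> ('c \<Rightarrow> real) \<Rightarrow> ('c \<Rightarrow> real) \<Rightarrow> 'c \<Rightarrow> real" where
  "mix t a b \<equiv> (\<lambda>v. (1 - t) * a v + t * b v)"

definition mixable :: "('a, 'b) monoid_scheme \<Rightarrow> ('a set \<Rightarrow> real) \<Rightarrow> ('a set \<Rightarrow> real) \<Rightarrow> bool" where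
  "mixable G a b \<longleftrightarrow>
     (\<forall>t\<in>{0..1}. 0 < level_measure G (mix t a b) (\<lambda>L. L \<in> proper_nontrivial_subgroups G))"

text \<open>The straight line stays in the simplex spanned by both supports, so every point on it is
  itself a weighted chain and no level is lost.\<close>

lemma mixable_chain:
  assumes G: "group G"
    and a: "a \<in> realization_points (proper_nontrivial_subgroups G) (\<subseteq>)"
    and b: "b \<in> realization_points (proper_nontrivial_subgroups G) (\<subseteq>)"
    and ch: "is_chain_in (\<subseteq>) ({H. a H \<noteq> 0} \<union> {H. b H \<noteq> 0})"
  shows "mixable G a b"
  unfolding mixable_def
proof
  fix t :: real assume t: "t \<in> {0..1}"
  let ?P = "proper_nontrivial_subgroups G"
  let ?C = "{H. a H \<noteq> 0} \<union> {H. b H \<noteq> 0}"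
  note aD = realization_points_memD[OF a] and bD = realization_points_memD[OF b]
  have fin: "finite ?C" using aD(3) bD(3) by simp
  have sub: "{H. mix t a b H \<noteq> 0} \<subseteq> ?C" by auto
  have "(\<Sum>H\<in>{H. mix t a b H \<noteq> 0}. mix t a b H) = (\<Sum>H\<in>?C. mix t a b H)"
    using fin by (intro sum.mono_neutral_left) auto
  also have "\<dots> = (1 - t) * (\<Sum>H\<in>?C. a H) + t * (\<Sum>H\<in>?C. b H)"
    by (simp add: sum.distrib sum_distrib_left)
  also have "(\<Sum>H\<in>?C. a H) = sum a {H. a H \<noteq> 0}"
    using fin by (intro sum.mono_neutral_right) auto
  also have "(\<Sum>H\<in>?C. b H) = sum b {H. b H \<noteq> 0}"
    using fin by (intro sum.mono_neutral_right) auto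
  finally have "(\<Sum>H\<in>{H. mix t a b H \<noteq> 0}. mix t a b H) = 1"
    using aD(5) bD(5) by simp
  moreover have "0 \<le> mix t a b H" for H using t aD(1)[of H] bD(1)[of H] by simp
  ultimately have "mix t a b \<in> realization_points ?P (\<subseteq>)"
    using aD(2) bD(2) finite_subset[OF sub fin] is_chain_in_subset[OF ch sub] sub
    unfolding realization_points_def by blast
  then show "0 < level_measure G (mix t a b) (\<lambda>L. L \<in> ?P)"
    using level_measure_of_chain(2)[OF G] by simp
qed

lemma finitary_map_level_chain:
  assumes G: "group G" and F: "finite F" "\<And>x. x \<in> topspace T \<Longrightarrow> {H. z x H \<noteq> 0} \<subseteq> F"
    and z: "\<And>H. continuous_map T euclideanreal (\<lambda>x. z x H)"
    and pos: "\<And>x. x \<in> topspace T \<Longrightarrow>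
      0 < level_measure G (z x) (\<lambda>L. L \<in> proper_nontrivial_subgroups G)"
  shows "finitary_map T (proper_nontrivial_subgroups G) (\<subseteq>) (\<lambda>x. level_chain G (z x))"
  unfolding finitary_map_def
proof (intro conjI ballI)
  fix x assume "x \<in> topspace T"
  then show "level_chain G (z x) \<in> realization_points (proper_nontrivial_subgroups G) (\<subseteq>)"
    by (intro level_chain_in_realization[OF G finite_subset[OF F(2) F(1)] pos])
next
  let ?F = "(\<lambda>W. generate G {g \<in> carrier G. {H \<in> F. g \<in> H} \<in> W}) ` Pow (Pow F)"
  have "\<forall>x\<in>topspace T. {K. level_chain G (z x) K \<noteq> 0} \<subseteq> ?F"
    by (intro ballI level_chain_support[OF F(1) F(2)])
  moreover have "finite ?F" using F(1) by simp
  ultimately show "\<exists>F. finite F \<and> (\<forall>x\<in>topspace T. {K. level_chain G (z x) K \<noteq> 0} \<subseteq> F)"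
    by blast
next
  have "continuous_map T euclideanreal (\<lambda>x. level_chain G (z x) K)" for K
  proof (cases "K \<in> proper_nontrivial_subgroups G")
    case True
    then show ?thesis
      unfolding level_chain_def
      using pos continuous_map_level_measure[OF F z]
      by (auto intro!: continuous_map_real_divide simp: less_imp_neq[THEN not_sym])
  qed (simp add: level_chain_def)
  then show "continuous_map T (powertop_real UNIV) (\<lambda>x. level_chain G (z x))"
    unfolding continuous_map_componentwise_UNIV by blast
qed

lemma finitary_map_mix:
  assumes G: "group G"
    and f: "finitary_map T (proper_nontrivial_subgroups G) (\<subseteq>) f"
    and g: "finitary_map T (proper_nontrivial_subgroups G) (\<subseteq>) g"
    and m: "\<And>x. x \<in> topspace T \<Longrightarrow> mixable G (f x) (g x)"
  shows "finitary_map (prod_topology (top_of_set {0..1}) T) (proper_nontrivial_subgroups G) (\<subseteq>)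
    (\<lambda>p. level_chain G (mix (fst p) (f (snd p)) (g (snd p))))"
proof -
  obtain F where F: "finite F" "\<And>x. x \<in> topspace T \<Longrightarrow> {v. f x v \<noteq> 0} \<subseteq> F"
    using f unfolding finitary_map_def by blast
  obtain F' where F': "finite F'" "\<And>x. x \<in> topspace T \<Longrightarrow> {v. g x v \<noteq> 0} \<subseteq> F'"
    using g unfolding finitary_map_def by blast
  let ?T = "prod_topology (top_of_set {0..1::real}) T"
  have cf: "continuous_map T euclideanreal (\<lambda>x. f x H)"
    and cg: "continuous_map T euclideanreal (\<lambda>x. g x H)" for H
    using f g unfolding finitary_map_def continuous_map_componentwise_UNIV by blast+
  have cfst: "continuous_map ?T euclideanreal fst"
    using continuous_map_fst[of "top_of_set {0..1::real}" T] continuous_map_in_subtopology by blast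
  have cs: "continuous_map ?T euclideanreal (\<lambda>p. h (snd p))"
    if "continuous_map T euclideanreal h" for h
    using continuous_map_compose[OF continuous_map_snd that] by (simp add: o_def)
  show ?thesis
  proof (rule finitary_map_level_chain[OF G])
    show "finite (F \<union> F')" using F F' by simp
    fix p assume p: "p \<in> topspace ?T"
    then have p': "fst p \<in> {0..1}" "snd p \<in> topspace T" by auto
    have "H \<in> F \<union> F'" if "mix (fst p) (f (snd p)) (g (snd p)) H \<noteq> 0" for H
    proof (rule ccontr)
      assume "H \<notin> F \<union> F'"
      then have "f (snd p) H = 0" "g (snd p) H = 0" using F(2)[OF p'(2)] F'(2)[OF p'(2)] by auto
      then show False using that by simp
    qed
    then show "{H. mix (fst p) (f (snd p)) (g (snd p)) H \<noteq> 0} \<subseteq> F \<union> F'" by blast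
    show "0 < level_measure G (mix (fst p) (f (snd p)) (g (snd p)))
        (\<lambda>L. L \<in> proper_nontrivial_subgroups G)"
      using m[OF p'(2)] p'(1) unfolding mixable_def by blast
  next
    show "continuous_map ?T euclideanreal (\<lambda>p. mix (fst p) (f (snd p)) (g (snd p)) H)" for H
      by (intro continuous_map_add continuous_map_real_mult continuous_map_diff cs cf cg cfst
          continuous_map_const[THEN iffD2]) auto
  qed
qed

text \<open>By \<open>level_chain_id\<close> the retraction fixes the two ends of each line, so the
  homotopy really runs from \<open>f\<close> to \<open>g\<close>.\<close>

lemma homotopic_with_mix:
  assumes "group G"
    and "finitary_map T (proper_nontrivial_subgroups G) (\<subseteq>) f"
    and "finitary_map T (proper_nontrivial_subgroups G) (\<subseteq>) g"
    and "\<And>x. x \<in> topspace T \<Longrightarrow> mixable G (f x) (g x)"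
  shows "homotopic_with (\<lambda>_. True) T
    (order_complex_realization (proper_nontrivial_subgroups G) (\<subseteq>)) f g"
proof -
  have fg: "level_chain G (f x) = f x" "level_chain G (g x) = g x" if "x \<in> topspace T" for x
    using level_chain_id[OF assms(1)] assms(2,3) that unfolding finitary_map_def by auto
  show ?thesis
    by (subst homotopic_with, simp,
        rule exI[of _ "\<lambda>p. level_chain G (mix (fst p) (f (snd p)) (g (snd p)))"])
      (use finitary_map_imp_continuous_map[OF finitary_map_mix[OF assms]] fg in simp)
qed

text \<open>The version for self-maps of the whole realization, where no finite set of vertices need
  suffice. The maps are finitary on each simplex only, and the homotopy is tested on products of the
  interval with simplices.\<close>

lemma homotopic_with_mix_realization:
  fixes G :: "('a, 'b) monoid_scheme"
  defines "P \<equiv> proper_nontrivial_subgroups G"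
  assumes G: "group G"
    and f: "\<And>C. finite C \<Longrightarrow> C \<subseteq> P \<Longrightarrow> is_chain_in (\<subseteq>) C \<Longrightarrow>
      finitary_map (subtopology (powertop_real UNIV) (realization_simplex P (\<subseteq>) C)) P (\<subseteq>) f"
    and g: "\<And>C. finite C \<Longrightarrow> C \<subseteq> P \<Longrightarrow> is_chain_in (\<subseteq>) C \<Longrightarrow>
      finitary_map (subtopology (powertop_real UNIV) (realization_simplex P (\<subseteq>) C)) P (\<subseteq>) g"
    and m: "\<And>a. a \<in> realization_points P (\<subseteq>) \<Longrightarrow> mixable G (f a) (g a)"
  shows "homotopic_with (\<lambda>_. True) (order_complex_realization P (\<subseteq>))
    (order_complex_realization P (\<subseteq>)) f g"
proof -
  let ?R = "order_complex_realization P (\<subseteq>)"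
  let ?h = "\<lambda>p. level_chain G (mix (fst p) (f (snd p)) (g (snd p)))"
  let ?S = "\<lambda>C. subtopology (powertop_real UNIV) (realization_simplex P (\<subseteq>) C)"
  have cont: "continuous_map (prod_topology (top_of_set {0..1}) ?R) ?R ?h"
  proof (rule continuous_map_prod_realization)
    show "locally_compact_space (top_of_set {0..1::real})"
      by (intro compact_imp_locally_compact_space compact_space_subtopology) simp
    show "Hausdorff_space (top_of_set {0..1::real})"
      by (simp add: Hausdorff_space_subtopology)
    fix C :: "'a set set" assume C: "finite C" "C \<subseteq> P" "is_chain_in (\<subseteq>) C"
    have "finitary_map (prod_topology (top_of_set {0..1}) (?S C)) P (\<subseteq>) ?h"
      unfolding P_def
    proof (rule finitary_map_mix[OF G])
      show "finitary_map (subtopology (powertop_real UNIV)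
          (realization_simplex (proper_nontrivial_subgroups G) (\<subseteq>) C))
          (proper_nontrivial_subgroups G) (\<subseteq>) f"
        using f[OF C] unfolding P_def .
      show "finitary_map (subtopology (powertop_real UNIV)
          (realization_simplex (proper_nontrivial_subgroups G) (\<subseteq>) C))
          (proper_nontrivial_subgroups G) (\<subseteq>) g"
        using g[OF C] unfolding P_def .
      fix a assume "a \<in> topspace (subtopology (powertop_real UNIV)
          (realization_simplex (proper_nontrivial_subgroups G) (\<subseteq>) C))"
      then show "mixable G (f a) (g a)"
        using m[of a] realization_simplex_subset unfolding P_def by auto
    qed
    then show "continuous_map (prod_topology (top_of_set {0..1}) (?S C)) ?R (\<lambda>(t, a). ?h (t, a))"
      using finitary_map_imp_continuous_map by (simp add: case_prod_unfold)
  qed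
  have fg: "level_chain G (f a) = f a" "level_chain G (g a) = g a"
    if "a \<in> realization_points P (\<subseteq>)" for a
  proof -
    let ?C = "{x. a x \<noteq> 0}"
    have C: "finite ?C" "?C \<subseteq> P" "is_chain_in (\<subseteq>) ?C" using realization_points_memD[OF that] by auto
    have "a \<in> topspace (?S ?C)" using that by (simp add: realization_simplex_def)
    then have "f a \<in> realization_points P (\<subseteq>)" "g a \<in> realization_points P (\<subseteq>)"
      using f[OF C] g[OF C] unfolding finitary_map_def by blast+
    then show "level_chain G (f a) = f a" "level_chain G (g a) = g a"
      using level_chain_id[OF G] unfolding P_def by blast+
  qed
  show ?thesis
    by (subst homotopic_with, simp, rule exI[of _ ?h]) (use cont fg in simp)
qed

section \<open>Complements of normal subgroups\<close>

definition complementary :: "('a, 'b) monoid_scheme \<Rightarrow> 'a set \<Rightarrow> 'a set \<Rightarrow> bool" where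
  "complementary G H N \<longleftrightarrow> H \<inter> N = {\<one>\<^bsub>G\<^esub>} \<and> generate G (H \<union> N) = carrier G"

text \<open>An instance of Dedekind's modular law.\<close>

lemma complementary_normal_unique:
  assumes "group G" "subgroup H G" "N \<lhd> G" "subgroup M G" "N \<subseteq> M"
    and HN: "complementary G H N" and HM: "complementary G H M"
  shows "M = N"
proof
  interpret group G by fact
  have "subgroup (N <#>\<^bsub>G\<^esub> H) G" using mult_norm_subgroup assms(2,3) by blast
  moreover have "H \<union> N \<subseteq> N <#>\<^bsub>G\<^esub> H"
  proof
    have N: "subgroup N G" using assms(3) normal_imp_subgroup by blast
    fix x assume x: "x \<in> H \<union> N"
    then have xc: "x \<in> carrier G" using assms(2) N subgroup.mem_carrier by fastforce
    from x show "x \<in> N <#>\<^bsub>G\<^esub> H"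
    proof
      assume "x \<in> H"
      then show ?thesis unfolding set_mult_def
        using xc subgroup.one_closed[OF N] l_one[OF xc] by force
    next
      assume "x \<in> N"
      then show ?thesis unfolding set_mult_def
        using xc subgroup.one_closed[OF assms(2)] r_one[OF xc] by force
    qed
  qed
  ultimately have gen: "carrier G \<subseteq> N <#>\<^bsub>G\<^esub> H"
    using HN generate_subgroup_incl unfolding complementary_def by blast
  \<comment> \<open>Write m = n h with n in \<open>N\<close> and h in \<open>H\<close>. Since
    \<open>N\<close> lies in \<open>M\<close>, h lies in \<open>H \<inter> M\<close>, which is
    trivial, and m = n.\<close>
  show "M \<subseteq> N"
  proof
    fix m assume m: "m \<in> M"
    have mc: "m \<in> carrier G" using m subgroup.mem_carrier[OF assms(4)] by blast
    then obtain n h where nh: "n \<in> N" "h \<in> H" "m = n \<otimes>\<^bsub>G\<^esub> h"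
      using gen unfolding set_mult_def by auto
    have hc: "h \<in> carrier G" using nh(2) subgroup.mem_carrier[OF assms(2)] by blast
    have nM: "n \<in> M" using nh(1) assms(5) by blast
    have nc: "n \<in> carrier G" using nM subgroup.mem_carrier[OF assms(4)] by blast
    have "h = inv\<^bsub>G\<^esub> n \<otimes>\<^bsub>G\<^esub> m" using nh(3) hc nc mc by (simp add: inv_solve_left)
    then have "h \<in> M"
      using subgroup.m_closed[OF assms(4) subgroup.m_inv_closed[OF assms(4) nM] m] by simp
    then have "h = \<one>\<^bsub>G\<^esub>" using HM nh(2) unfolding complementary_def by blast
    then show "m \<in> N" using nh nc by simp
  qed
qed (fact assms(5))

lemma chain_has_least_greatest:
  assumes "finite C" "C \<noteq> {}" "is_chain_in (\<subseteq>) C"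
  shows "\<exists>L\<in>C. \<forall>H\<in>C. L \<subseteq> H" "\<exists>U\<in>C. \<forall>H\<in>C. H \<subseteq> U"
proof -
  obtain L where "L \<in> C" "\<forall>H\<in>C. H \<subseteq> L \<longrightarrow> L = H"
    using finite_has_minimal[OF assms(1,2)] by auto
  then show "\<exists>L\<in>C. \<forall>H\<in>C. L \<subseteq> H" using assms(3) unfolding is_chain_in_def by blast
  obtain U where "U \<in> C" "\<forall>H\<in>C. U \<subseteq> H \<longrightarrow> U = H"
    using finite_has_maximal[OF assms(1,2)] by auto
  then show "\<exists>U\<in>C. \<forall>H\<in>C. H \<subseteq> U" using assms(3) unfolding is_chain_in_def by blast
qed

text \<open>Only the least subgroup of the first chain and the greatest one of the second matter:
  if they meet nontrivially, the levels just above \<open>1 - t\<close> lie between their intersection and the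
  latter; if they do not generate the group, the levels just below \<open>1 - t\<close> lie between the former
  and their join.\<close>

lemma mixable_not_complementary:
  assumes G: "group G"
    and a: "a \<in> realization_points (proper_nontrivial_subgroups G) (\<subseteq>)"
    and b: "b \<in> realization_points (proper_nontrivial_subgroups G) (\<subseteq>)"
    and nc: "\<And>H N. a H \<noteq> 0 \<Longrightarrow> b N \<noteq> 0 \<Longrightarrow> \<not> complementary G H N"
  shows "mixable G a b"
  unfolding mixable_def
proof
  fix t :: real assume t: "t \<in> {0..1}"
  let ?P = "proper_nontrivial_subgroups G"
  let ?A = "{H. a H \<noteq> 0}" and ?B = "{H. b H \<noteq> 0}"
  let ?z = "mix t a b"
  note aD = realization_points_memD[OF a] and bD = realization_points_memD[OF b]
  have "?A \<noteq> {}"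
  proof
    assume "?A = {}"
    then show False using aD(5) by simp
  qed
  then obtain L where L: "L \<in> ?A" "\<And>H. H \<in> ?A \<Longrightarrow> L \<subseteq> H"
    using chain_has_least_greatest(1)[OF aD(3) _ aD(4)] by meson
  have "?B \<noteq> {}"
  proof
    assume "?B = {}"
    then show False using bD(5) by simp
  qed
  then obtain U where U: "U \<in> ?B" "\<And>H. H \<in> ?B \<Longrightarrow> H \<subseteq> U"
    using chain_has_least_greatest(2)[OF bD(3) _ bD(4)] by meson
  have LP: "L \<in> ?P" and UP: "U \<in> ?P" using L(1) U(1) aD(2) bD(2) by auto
  then have sub: "subgroup L G" "subgroup U G" and ne: "L \<noteq> {\<one>\<^bsub>G\<^esub>}" "U \<noteq> carrier G"
    unfolding proper_nontrivial_subgroups_def by auto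
  have aL: "0 < a L" and bU: "0 < b U" using L(1) U(1) aD(1)[of L] bD(1)[of U] by auto
  define p where "p g = sum a {H. a H \<noteq> 0 \<and> g \<in> H}" for g
  define q where "q g = sum b {H. b H \<noteq> 0 \<and> g \<in> H}" for g
  have fin: "finite (?A \<union> ?B)" using aD(3) bD(3) by simp
  have suppz: "{H. ?z H \<noteq> 0} \<subseteq> ?A \<union> ?B" by auto
  have finz: "finite {H. ?z H \<noteq> 0}" using finite_subset[OF suppz fin] .
  have psi: "(\<Sum>H | ?z H \<noteq> 0 \<and> g \<in> H. ?z H) = (1 - t) * p g + t * q g" for g
  proof -
    let ?S = "{H \<in> ?A \<union> ?B. g \<in> H}"
    have finS: "finite ?S" by (rule finite_subset[OF _ fin]) blast
    have "(\<Sum>H | ?z H \<noteq> 0 \<and> g \<in> H. ?z H) = (\<Sum>H\<in>?S. ?z H)"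
      by (rule sum.mono_neutral_left[OF finS]) (use suppz in blast)+
    also have "\<dots> = (1 - t) * (\<Sum>H\<in>?S. a H) + t * (\<Sum>H\<in>?S. b H)"
      by (simp add: sum.distrib sum_distrib_left)
    also have "(\<Sum>H\<in>?S. a H) = p g"
      unfolding p_def by (rule sum.mono_neutral_right[OF finS]) blast+
    also have "(\<Sum>H\<in>?S. b H) = q g"
      unfolding q_def by (rule sum.mono_neutral_right[OF finS]) blast+
    finally show ?thesis .
  qed
  have lev: "level_subgroup G ?z s = generate G {g \<in> carrier G. s \<le> (1 - t) * p g + t * q g}" for s
    unfolding level_subgroup_def psi ..
  have p_le1: "p g \<le> 1" for g
    unfolding p_def aD(5)[symmetric] using aD(1,3) by (intro sum_mono2) auto
  have q_ge0: "0 \<le> q g" for g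
    unfolding q_def using bD(1) by (intro sum_nonneg) auto
  have pL: "p g = 1" if "g \<in> L" for g
  proof -
    have "{H. a H \<noteq> 0 \<and> g \<in> H} = ?A" using L(2) that by auto
    then show ?thesis unfolding p_def using aD(5) by simp
  qed
  have p_notL: "p g \<le> 1 - a L" if "g \<notin> L" for g
  proof -
    have "a L + p g = sum a (insert L {H. a H \<noteq> 0 \<and> g \<in> H})"
      unfolding p_def using that aD(3) by (subst sum.insert) auto
    also have "\<dots> \<le> sum a ?A" using L(1) aD(1,3) by (intro sum_mono2) auto
    finally show ?thesis using aD(5) by simp
  qed
  have qU: "b U \<le> q g" if "g \<in> U" for g
    unfolding q_def using that U(1) bD(1,3) by (intro member_le_sum) auto
  have q_notU: "q g = 0" if "g \<notin> U" for g
  proof -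
    have "{H. b H \<noteq> 0 \<and> g \<in> H} = {}" using U(2) that by auto
    then show ?thesis by (simp only: q_def sum.empty)
  qed
  have bU1: "b U \<le> 1" using q_notU member_le_sum[of U ?B b] U(1) bD(1,3,5) by auto
  have aL1: "a L \<le> 1" using member_le_sum[of L ?A a] L(1) aD(1,3,5) by auto
  have inP: "level_subgroup G ?z s \<in> ?P"
    if "g \<in> level_subgroup G ?z s" "g \<noteq> \<one>\<^bsub>G\<^esub>" "level_subgroup G ?z s \<subseteq> K" "K \<subset> carrier G" for s g K
    using that level_subgroup_is_subgroup[OF G, of ?z s]
    unfolding proper_nontrivial_subgroups_def by blast
  \<comment> \<open>At either end one of the two intervals of levels used below shrinks to length 0,
    but there the weight is \<open>a\<close> or \<open>b\<close> itself.\<close>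
  consider "t = 0" | "t = 1" | "0 < t" "t < 1" using t by force
  then show "0 < level_measure G ?z (\<lambda>L. L \<in> ?P)"
  proof cases
    case 1
    then show ?thesis using level_measure_of_chain(2)[OF G a] by simp
  next
    case 2
    then show ?thesis using level_measure_of_chain(2)[OF G b] by simp
  next
    case 3
    show ?thesis
    proof (cases "L \<inter> U = {\<one>\<^bsub>G\<^esub>}")
      case False
      then obtain g where g: "g \<in> L" "g \<in> U" "g \<noteq> \<one>\<^bsub>G\<^esub>"
        using subgroup.one_closed[OF sub(1)] subgroup.one_closed[OF sub(2)] by blast
      \<comment> \<open>Outside \<open>U\<close> only the first chain contributes, at most
        \<open>1 - t\<close>; an element of \<open>L \<inter> U\<close> gets all of
        \<open>1 - t\<close> and at least \<open>t * b U\<close> in addition.\<close>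
      have "level_subgroup G ?z s \<in> ?P" if s: "s \<in> {1 - t<..1 - t + t * b U}" for s
      proof (rule inP[of g _ U])
        have "t * b U \<le> t * q g" using qU[OF g(2)] 3 by simp
        then have "g \<in> {g \<in> carrier G. s \<le> (1 - t) * p g + t * q g}"
          using pL[OF g(1)] s subgroup.mem_carrier[OF sub(1) g(1)] by auto
        then show "g \<in> level_subgroup G ?z s" unfolding lev by (rule generate.incl)
        have "{g \<in> carrier G. s \<le> (1 - t) * p g + t * q g} \<subseteq> U"
        proof
          fix g' assume g': "g' \<in> {g \<in> carrier G. s \<le> (1 - t) * p g + t * q g}"
          show "g' \<in> U"
          proof (rule ccontr)
            assume "g' \<notin> U"
            then have "s \<le> (1 - t) * p g'" using g' q_notU by simp
            also have "\<dots> \<le> 1 - t" using 3 p_le1[of g'] by (simp add: mult_left_le)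
            finally show False using s by simp
          qed
        qed
        then show "level_subgroup G ?z s \<subseteq> U"
          unfolding lev using group.generate_subgroup_incl[OF G _ sub(2)] by blast
        show "U \<subset> carrier G" using ne(2) subgroup.subset[OF sub(2)] by blast
      qed (fact g(3))
      moreover have "t * b U \<le> t" using 3 bU1 by (simp add: mult_left_le)
      ultimately have "1 - t + t * b U - (1 - t) \<le> level_measure G ?z (\<lambda>L. L \<in> ?P)"
        using 3 bU by (intro level_measure_ge_interval finz) auto
      moreover have "0 < t * b U" using 3 bU by simp
      ultimately show ?thesis by linarith
    next
      case True
      let ?J = "generate G (L \<union> U)"
      have LUc: "L \<union> U \<subseteq> carrier G" using subgroup.subset sub by blast
      have J: "subgroup ?J G" using group.generate_is_subgroup[OF G LUc] .
      have Jne: "?J \<noteq> carrier G"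
        using nc[of L U] L(1) U(1) True unfolding complementary_def by auto
      obtain g where g: "g \<in> L" "g \<noteq> \<one>\<^bsub>G\<^esub>" using ne(1) subgroup.one_closed[OF sub(1)] by blast
      \<comment> \<open>Outside \<open>L \<union> U\<close> the weight of \<open>L\<close> is
        missing as well, which leaves at most \<open>(1 - t) * (1 - a L)\<close>; every element of
        \<open>L\<close> reaches \<open>1 - t\<close>.\<close>
      have "level_subgroup G ?z s \<in> ?P" if s: "s \<in> {(1 - t) * (1 - a L)<..1 - t}" for s
      proof (rule inP[of g _ ?J])
        have "0 \<le> t * q g" using q_ge0 3 by simp
        then have "g \<in> {g \<in> carrier G. s \<le> (1 - t) * p g + t * q g}"
          using pL[OF g(1)] s subgroup.mem_carrier[OF sub(1) g(1)] by auto
        then show "g \<in> level_subgroup G ?z s" unfolding lev by (rule generate.incl)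
        have "{g \<in> carrier G. s \<le> (1 - t) * p g + t * q g} \<subseteq> L \<union> U"
        proof
          fix g' assume g': "g' \<in> {g \<in> carrier G. s \<le> (1 - t) * p g + t * q g}"
          show "g' \<in> L \<union> U"
          proof (rule ccontr)
            assume n: "g' \<notin> L \<union> U"
            then have "s \<le> (1 - t) * p g'" using g' q_notU by simp
            also have "\<dots> \<le> (1 - t) * (1 - a L)"
              using 3 p_notL[of g'] n by (intro mult_left_mono) auto
            finally show False using s by simp
          qed
        qed
        then have "{g \<in> carrier G. s \<le> (1 - t) * p g + t * q g} \<subseteq> ?J"
          using generate.incl[of _ "L \<union> U" G] by blast
        then show "level_subgroup G ?z s \<subseteq> ?J"
          unfolding lev using group.generate_subgroup_incl[OF G _ J] by blast
        show "?J \<subset> carrier G" using Jne subgroup.subset[OF J] by blast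
      qed (fact g(2))
      moreover have "0 \<le> (1 - t) * (1 - a L)" "(1 - t) * (1 - a L) \<le> 1 - t" "1 - t \<le> 1"
        using 3 aL aL1 by (auto simp: mult_left_le)
      ultimately have "1 - t - (1 - t) * (1 - a L) \<le> level_measure G ?z (\<lambda>L. L \<in> ?P)"
        by (intro level_measure_ge_interval finz) auto
      moreover have "1 - t - (1 - t) * (1 - a L) = (1 - t) * a L" by (simp add: algebra_simps)
      moreover have "0 < (1 - t) * a L" using 3 aL by simp
      ultimately show ?thesis by linarith
    qed
  qed
qed

section \<open>Homotopies driven by a chain of normal subgroups\<close>

definition normalize_weights :: "('c \<Rightarrow> real) \<Rightarrow> 'c \<Rightarrow> real" where
  "normalize_weights y = (\<lambda>v. y v / sum y {v. y v \<noteq> 0})"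

lemma normalize_weights:
  assumes "\<And>v. 0 \<le> y v" "finite {v. y v \<noteq> 0}" "y w \<noteq> 0"
  shows "0 < sum y {v. y v \<noteq> 0}"
    and "{v. normalize_weights y v \<noteq> 0} = {v. y v \<noteq> 0}"
    and "0 \<le> normalize_weights y v"
    and "sum (normalize_weights y) {v. normalize_weights y v \<noteq> 0} = 1"
proof -
  have "0 < y w" using assms(1)[of w] assms(3) by simp
  also have "y w \<le> sum y {v. y v \<noteq> 0}" using assms by (intro member_le_sum) auto
  finally show pos: "0 < sum y {v. y v \<noteq> 0}" .
  then show eq: "{v. normalize_weights y v \<noteq> 0} = {v. y v \<noteq> 0}"
    by (simp add: normalize_weights_def)
  show "0 \<le> normalize_weights y v" using pos assms(1) by (simp add: normalize_weights_def)
  show "sum (normalize_weights y) {v. normalize_weights y v \<noteq> 0} = 1"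
    unfolding eq using pos by (simp add: normalize_weights_def flip: sum_divide_distrib)
qed

lemma finitary_map_normalize_weights:
  assumes F: "finite F" "F \<subseteq> P" "\<And>x. x \<in> topspace T \<Longrightarrow> {v. y x v \<noteq> 0} \<subseteq> F"
    and y0: "\<And>x v. x \<in> topspace T \<Longrightarrow> 0 \<le> y x v"
    and ne: "\<And>x. x \<in> topspace T \<Longrightarrow> \<exists>v. y x v \<noteq> 0"
    and ch: "\<And>x. x \<in> topspace T \<Longrightarrow> is_chain_in rel {v. y x v \<noteq> 0}"
    and co: "\<And>v. continuous_map T euclideanreal (\<lambda>x. y x v)"
  shows "finitary_map T P rel (\<lambda>x. normalize_weights (y x))"
  unfolding finitary_map_def
proof (intro conjI ballI)
  note fin = finite_subset[OF F(3) F(1)]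
  fix x assume x: "x \<in> topspace T"
  obtain w where w: "y x w \<noteq> 0" using ne[OF x] by blast
  note n = normalize_weights[of "y x", OF y0[OF x] fin[OF x] w]
  show "normalize_weights (y x) \<in> realization_points P rel"
    unfolding realization_points_def mem_Collect_eq n(4)
    using n(3) F(3)[OF x] F(2) fin[OF x] ch[OF x] unfolding n(2) by blast
next
  have "{v. normalize_weights (y x) v \<noteq> 0} \<subseteq> F" if "x \<in> topspace T" for x
    using F(3)[OF that] by (auto simp: normalize_weights_def)
  then show "\<exists>F. finite F \<and> (\<forall>x\<in>topspace T. {v. normalize_weights (y x) v \<noteq> 0} \<subseteq> F)"
    using F(1) by blast
next
  have "continuous_map T euclideanreal (\<lambda>x. normalize_weights (y x) v)" for v
  proof -
    have pos: "0 < sum (y x) {v. y x v \<noteq> 0}" if x: "x \<in> topspace T" for x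
    proof -
      obtain w where w: "y x w \<noteq> 0" using ne[OF x] by blast
      show ?thesis
        by (rule normalize_weights(1)[of "y x", OF y0[OF x] finite_subset[OF F(3)[OF x] F(1)] w])
    qed
    have eq: "sum (y x) {v. y x v \<noteq> 0} = sum (y x) F" if "x \<in> topspace T" for x
      using F(3)[OF that] F(1) by (intro sum.mono_neutral_left) auto
    have "continuous_map T euclideanreal (\<lambda>x. y x v / sum (y x) F)"
    proof (rule continuous_map_real_divide[OF co])
      show "continuous_map T euclideanreal (\<lambda>x. sum (y x) F)"
        by (rule continuous_map_sum[OF F(1) co])
      show "sum (y x) F \<noteq> 0" if "x \<in> topspace T" for x using pos[OF that] eq[OF that] by simp
    qed
    then show ?thesis
      by (rule continuous_map_eq) (simp add: normalize_weights_def eq)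
  qed
  then show "continuous_map T (powertop_real UNIV) (\<lambda>x. normalize_weights (y x))"
    unfolding continuous_map_componentwise_UNIV by blast
qed

text \<open>Only pairwise comparability is required, no monotonicity in the index. \<open>J\<close>
  becomes \<open>{..<d - 1}\<close> for a chief series of length \<open>d\<close>, and
  \<open>UNIV\<close> if there is none.\<close>

locale normal_chain =
  fixes G :: "('a, 'b) monoid_scheme" and N :: "nat \<Rightarrow> 'a set" and J :: "nat set"
  assumes G: "group G"
    and normal: "i \<in> J \<Longrightarrow> N i \<lhd> G"
    and proper: "i \<in> J \<Longrightarrow> N i \<in> proper_nontrivial_subgroups G"
    and inj: "inj_on N J"
    and chain: "i \<in> J \<Longrightarrow> j \<in> J \<Longrightarrow> N i \<subseteq> N j \<or> N j \<subseteq> N i"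
begin

abbreviation P :: "'a set set" where "P \<equiv> proper_nontrivial_subgroups G"

lemma complement_index_unique:
  assumes "H \<in> P" "i \<in> J" "j \<in> J" "complementary G H (N i)" "complementary G H (N j)"
  shows "i = j"
proof -
  have H: "subgroup H G" using assms(1) unfolding proper_nontrivial_subgroups_def by blast
  have s: "subgroup (N i) G" "subgroup (N j) G"
    using normal_imp_subgroup normal assms(2,3) by blast+
  have "N i = N j"
    using chain[OF assms(2,3)]
  proof
    assume "N i \<subseteq> N j"
    from complementary_normal_unique[OF G H normal[OF assms(2)] s(2) this assms(4,5)]
    show ?thesis by simp
  next
    assume "N j \<subseteq> N i"
    from complementary_normal_unique[OF G H normal[OF assms(3)] s(1) this assms(5,4)]
    show ?thesis by simp
  qed
  then show ?thesis using inj assms(2,3) by (simp add: inj_on_eq_iff)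
qed

lemma finite_complement_index:
  assumes "H \<in> P"
  shows "finite {i. i \<in> J \<and> complementary G H (N i)}"
proof (cases "{i. i \<in> J \<and> complementary G H (N i)} = {}")
  case False
  then obtain i where "i \<in> J" "complementary G H (N i)" by blast
  then have "{i. i \<in> J \<and> complementary G H (N i)} \<subseteq> {i}"
    using complement_index_unique[OF assms] by blast
  then show ?thesis using finite_subset by blast
qed (simp only: finite.emptyI)

text \<open>For \<open>H\<close> in \<open>P\<close> the product has at most one factor, by
  uniqueness of the index: complements of \<open>N i\<close> are scaled by \<open>c i\<close>, and
  subgroups that complement no member of the chain keep their weight.\<close>

definition damp :: "(nat \<Rightarrow> real) \<Rightarrow> ('a set \<Rightarrow> real) \<Rightarrow> 'a set \<Rightarrow> real" where
  "damp c a H = a H * (\<Prod>i | i \<in> J \<and> complementary G H (N i). c i)"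

definition spread :: "(nat \<Rightarrow> real) \<Rightarrow> 'a set \<Rightarrow> real" where
  "spread u K = (\<Sum>i | i \<in> J \<and> N i = K. u i)"

lemma index_singleton: "i \<in> J \<Longrightarrow> {j. j \<in> J \<and> N j = N i} = {i}"
  using inj by (auto simp: inj_on_eq_iff)

lemma spread_eq: "i \<in> J \<Longrightarrow> spread u (N i) = u i"
  by (simp add: spread_def index_singleton)

lemma spread_eq_0: "K \<notin> N ` J \<Longrightarrow> spread u K = 0"
proof -
  assume "K \<notin> N ` J"
  then have "{i. i \<in> J \<and> N i = K} = {}" by blast
  then show ?thesis by (simp only: spread_def sum.empty)
qed

lemma damp_nonzero:
  assumes "damp c a H \<noteq> 0" "H \<in> P"
  shows "a H \<noteq> 0" "\<And>i. i \<in> J \<Longrightarrow> complementary G H (N i) \<Longrightarrow> c i \<noteq> 0"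
proof -
  show "a H \<noteq> 0" using assms(1) by (auto simp: damp_def)
  fix i assume i: "i \<in> J" "complementary G H (N i)"
  have "(\<Prod>i | i \<in> J \<and> complementary G H (N i). c i) \<noteq> 0"
    using assms(1) by (auto simp: damp_def)
  then show "c i \<noteq> 0"
    using i finite_complement_index[OF assms(2)] by (subst (asm) prod_zero_iff) auto
qed

text \<open>The three lines of the null-homotopy, for finite and infinite chains alike. Damping by
  \<open>c\<close> shrinks supports, so the first line stays in a simplex. Since \<open>c\<close>
  vanishes wherever \<open>u\<close> does not, no complement of a member weighted by
  \<open>u\<close> survives, and the second line is admissible. The third runs inside the simplex
  spanned by the chain. The condition \<open>cpos\<close> keeps damping from erasing
  \<open>f x\<close> entirely, and the finite set \<open>J'\<close> keeps the middle map
  finitary.\<close>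

lemma nullhomotopy_data:
  assumes f: "finitary_map T P (\<subseteq>) f"
    and c: "\<And>i. i \<in> J \<Longrightarrow> continuous_map T euclideanreal (\<lambda>x. c x i)"
    and u: "\<And>i. i \<in> J \<Longrightarrow> continuous_map T euclideanreal (\<lambda>x. u x i)"
    and c0: "\<And>x i. x \<in> topspace T \<Longrightarrow> i \<in> J \<Longrightarrow> 0 \<le> c x i"
    and u0: "\<And>x i. x \<in> topspace T \<Longrightarrow> i \<in> J \<Longrightarrow> 0 \<le> u x i"
    and J': "finite J'" "J' \<subseteq> J" "\<And>x i. x \<in> topspace T \<Longrightarrow> i \<in> J - J' \<Longrightarrow> u x i = 0"
    and cu: "\<And>x i. x \<in> topspace T \<Longrightarrow> i \<in> J \<Longrightarrow> c x i = 0 \<or> u x i = 0"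
    and upos: "\<And>x. x \<in> topspace T \<Longrightarrow> \<exists>i\<in>J. u x i \<noteq> 0"
    and cpos: "\<And>x. x \<in> topspace T \<Longrightarrow>
      \<exists>H. f x H \<noteq> 0 \<and> (\<forall>i\<in>J. complementary G H (N i) \<longrightarrow> c x i \<noteq> 0)"
    and k: "k \<in> J"
  shows "finitary_map T P (\<subseteq>) (\<lambda>x. normalize_weights (damp (c x) (f x)))"
    and "finitary_map T P (\<subseteq>) (\<lambda>x. normalize_weights (spread (u x)))"
    and "finitary_map T P (\<subseteq>) (\<lambda>x K. if K = N k then 1 else 0)"
    and "x \<in> topspace T \<Longrightarrow> mixable G (f x) (normalize_weights (damp (c x) (f x)))"
    and "x \<in> topspace T \<Longrightarrow>
      mixable G (normalize_weights (damp (c x) (f x))) (normalize_weights (spread (u x)))"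
    and "x \<in> topspace T \<Longrightarrow>
      mixable G (normalize_weights (spread (u x))) (\<lambda>K. if K = N k then 1 else 0)"
proof -
  obtain F where F: "finite F" "\<And>x. x \<in> topspace T \<Longrightarrow> {v. f x v \<noteq> 0} \<subseteq> F"
    using f unfolding finitary_map_def by blast
  have fpt: "f x \<in> realization_points P (\<subseteq>)" if "x \<in> topspace T" for x
    using f that unfolding finitary_map_def by blast
  note fD = realization_points_memD[OF fpt]
  have cf: "continuous_map T euclideanreal (\<lambda>x. f x H)" for H
    using f unfolding finitary_map_def continuous_map_componentwise_UNIV by blast
  have dsub: "{H. damp (c x) (f x) H \<noteq> 0} \<subseteq> {H. f x H \<noteq> 0}" for x
    by (auto simp: damp_def)
  show damped: "finitary_map T P (\<subseteq>) (\<lambda>x. normalize_weights (damp (c x) (f x)))"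
  proof (rule finitary_map_normalize_weights)
    show "finite (F \<inter> P)" "F \<inter> P \<subseteq> P" using F(1) by auto
    fix x assume x: "x \<in> topspace T"
    show "{H. damp (c x) (f x) H \<noteq> 0} \<subseteq> F \<inter> P"
      using dsub[of x] F(2)[OF x] fD(2)[OF x] by blast
    show "is_chain_in (\<subseteq>) {H. damp (c x) (f x) H \<noteq> 0}"
      using is_chain_in_subset[OF fD(4)[OF x] dsub] .
    show "0 \<le> damp (c x) (f x) H" for H
      unfolding damp_def by (intro mult_nonneg_nonneg prod_nonneg ballI fD(1)[OF x]) (simp add: c0[OF x])
    obtain H where H: "f x H \<noteq> 0" "\<forall>i\<in>J. complementary G H (N i) \<longrightarrow> c x i \<noteq> 0"
      using cpos[OF x] by blast
    then have HP: "H \<in> P" using fD(2)[OF x] by blast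
    have "(\<Prod>i | i \<in> J \<and> complementary G H (N i). c x i) \<noteq> 0"
      using H(2) by (subst prod_zero_iff[OF finite_complement_index[OF HP]]) blast
    then show "\<exists>H. damp (c x) (f x) H \<noteq> 0" using H(1) unfolding damp_def by (intro exI[of _ H]) simp
  next
    fix H
    have "continuous_map T euclideanreal (\<lambda>x. \<Prod>i | i \<in> J \<and> complementary G H (N i). c x i)"
    \<comment> \<open>An infinite index set can occur only for \<open>H\<close> outside
      \<open>P\<close>; the product then has the default value 1 and is constant.\<close>
    proof (cases "finite {i. i \<in> J \<and> complementary G H (N i)}")
      case True
      then show ?thesis using c by (intro continuous_map_prod) auto
    qed simp
    then show "continuous_map T euclideanreal (\<lambda>x. damp (c x) (f x) H)"
      unfolding damp_def by (intro continuous_map_real_mult cf)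
  qed
  have PN: "N ` J \<subseteq> P" using proper by blast
  have ssub: "{K. spread (u x) K \<noteq> 0} \<subseteq> N ` J'" if x: "x \<in> topspace T" for x
  proof
    fix K assume "K \<in> {K. spread (u x) K \<noteq> 0}"
    then have K: "spread (u x) K \<noteq> 0" by simp
    then have "K \<in> N ` J" using spread_eq_0[of K "u x"] by argo
    then obtain i where i: "i \<in> J" "K = N i" by blast
    have "u x i \<noteq> 0" using K spread_eq[OF i(1), of "u x"] unfolding i(2) by argo
    then show "K \<in> N ` J'" using i J'(3)[OF x, of i] by blast
  qed
  show spreaded: "finitary_map T P (\<subseteq>) (\<lambda>x. normalize_weights (spread (u x)))"
  proof (rule finitary_map_normalize_weights)
    show "finite (N ` J')" "N ` J' \<subseteq> P" using J'(1,2) PN by blast+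
    fix x assume x: "x \<in> topspace T"
    show "{K. spread (u x) K \<noteq> 0} \<subseteq> N ` J'" by (rule ssub[OF x])
    show "is_chain_in (\<subseteq>) {K. spread (u x) K \<noteq> 0}"
    proof (rule is_chain_in_subset[OF _ ssub[OF x]])
      show "is_chain_in (\<subseteq>) (N ` J')" using chain J'(2) unfolding is_chain_in_def by blast
    qed
    show "0 \<le> spread (u x) K" for K
      unfolding spread_def by (intro sum_nonneg) (simp add: u0[OF x])
    obtain i where "i \<in> J" "u x i \<noteq> 0" using upos[OF x] by blast
    then show "\<exists>K. spread (u x) K \<noteq> 0" by (intro exI[of _ "N i"]) (simp add: spread_eq)
  next
    fix K
    show "continuous_map T euclideanreal (\<lambda>x. spread (u x) K)"
    proof (cases "K \<in> N ` J")
      case True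
      then obtain i where "i \<in> J" "K = N i" by blast
      then show ?thesis using u by (simp add: spread_eq)
    qed (simp add: spread_eq_0)
  qed
  show point: "finitary_map T P (\<subseteq>) (\<lambda>x K. if K = N k then 1 else 0)"
    unfolding finitary_map_def
  proof (intro conjI ballI)
    have s: "{K. (if K = N k then 1 else 0 :: real) \<noteq> 0} = {N k}" by auto
    show "(\<lambda>K. if K = N k then 1 else 0) \<in> realization_points P (\<subseteq>)"
      unfolding realization_points_def mem_Collect_eq s using PN k by (auto simp: is_chain_in_def)
    show "\<exists>F. finite F \<and> (\<forall>x\<in>topspace T. {K. (if K = N k then 1 else 0 :: real) \<noteq> 0} \<subseteq> F)"
      unfolding s by (intro exI[of _ "{N k}"]) simp
    show "continuous_map T (powertop_real UNIV) (\<lambda>x K. if K = N k then 1 else 0)"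
      unfolding continuous_map_componentwise_UNIV by simp
  qed
  assume x: "x \<in> topspace T"
  have pt: "normalize_weights (damp (c x) (f x)) \<in> realization_points P (\<subseteq>)"
    "normalize_weights (spread (u x)) \<in> realization_points P (\<subseteq>)"
    "(\<lambda>K. if K = N k then 1 else 0) \<in> realization_points P (\<subseteq>)"
    using damped spreaded point x unfolding finitary_map_def by blast+
  have nsub: "{v. normalize_weights y v \<noteq> 0} \<subseteq> {v. y v \<noteq> 0}" for y :: "'a set \<Rightarrow> real"
    by (auto simp: normalize_weights_def)
  show "mixable G (f x) (normalize_weights (damp (c x) (f x)))"
  proof (rule mixable_chain[OF G fpt[OF x] pt(1)])
    have "{H. f x H \<noteq> 0} \<union> {H. normalize_weights (damp (c x) (f x)) H \<noteq> 0} = {H. f x H \<noteq> 0}"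
      using nsub[of "damp (c x) (f x)"] dsub[of x] by blast
    then show "is_chain_in (\<subseteq>) ({H. f x H \<noteq> 0} \<union> {H. normalize_weights (damp (c x) (f x)) H \<noteq> 0})"
      using fD(4)[OF x] by (simp only:)
  qed
  show "mixable G (normalize_weights (damp (c x) (f x))) (normalize_weights (spread (u x)))"
  proof (rule mixable_not_complementary[OF G pt(1,2)])
    fix H K assume H: "normalize_weights (damp (c x) (f x)) H \<noteq> 0"
      and K: "normalize_weights (spread (u x)) K \<noteq> 0"
    have HP: "H \<in> P" using H realization_points_memD(2)[OF pt(1)] by blast
    have d: "damp (c x) (f x) H \<noteq> 0" using H nsub by blast
    have sp: "spread (u x) K \<noteq> 0" using K nsub by blast
    then have "K \<in> N ` J" using spread_eq_0[of K "u x"] by argo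
    then obtain i where i: "i \<in> J" "K = N i" by blast
    have ui: "u x i \<noteq> 0" using sp spread_eq[OF i(1), of "u x"] unfolding i(2) by argo
    show "\<not> complementary G H K"
    proof
      assume "complementary G H K"
      then have "c x i \<noteq> 0" using damp_nonzero(2)[OF d HP i(1)] i(2) by blast
      then show False using cu[OF x i(1)] ui by argo
    qed
  qed
  show "mixable G (normalize_weights (spread (u x))) (\<lambda>K. if K = N k then 1 else 0)"
  proof (rule mixable_chain[OF G pt(2,3)])
    have "{H. normalize_weights (spread (u x)) H \<noteq> 0} \<subseteq> N ` J"
      using nsub[of "spread (u x)"] ssub[OF x] J'(2) by blast
    moreover have "{H. (if H = N k then 1 else 0 :: real) \<noteq> 0} \<subseteq> N ` J" using k by auto
    ultimately have "{H. normalize_weights (spread (u x)) H \<noteq> 0} \<union>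
        {H. (if H = N k then 1 else 0 :: real) \<noteq> 0} \<subseteq> N ` J" by blast
    moreover have "is_chain_in (\<subseteq>) (N ` J)" using chain unfolding is_chain_in_def by blast
    ultimately show "is_chain_in (\<subseteq>) ({H. normalize_weights (spread (u x)) H \<noteq> 0} \<union>
        {H. (if H = N k then 1 else 0 :: real) \<noteq> 0})"
      using is_chain_in_subset by blast
  qed
qed

section \<open>The mass carried by complements\<close>

definition complement_mass :: "('a set \<Rightarrow> real) \<Rightarrow> nat \<Rightarrow> real" where
  "complement_mass a i = (\<Sum>H | a H \<noteq> 0 \<and> complementary G H (N i). a H)"

definition free_mass :: "('a set \<Rightarrow> real) \<Rightarrow> real" where
  "free_mass a = (\<Sum>H | a H \<noteq> 0 \<and> (\<forall>i\<in>J. \<not> complementary G H (N i)). a H)"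

lemma mass_sum_eq:
  assumes "finite F" "{H. a H \<noteq> 0} \<subseteq> F"
  shows "(\<Sum>H | a H \<noteq> 0 \<and> Q H. a H) = (\<Sum>H\<in>{H \<in> F. Q H}. a H)"
  using assms by (intro sum.mono_neutral_left) auto

lemma continuous_map_mass:
  assumes f: "finitary_map T P (\<subseteq>) f"
  shows "continuous_map T euclideanreal (\<lambda>x. \<Sum>H | f x H \<noteq> 0 \<and> Q H. f x H)"
proof -
  obtain F where F: "finite F" "\<And>x. x \<in> topspace T \<Longrightarrow> {v. f x v \<noteq> 0} \<subseteq> F"
    using f unfolding finitary_map_def by blast
  have "continuous_map T euclideanreal (\<lambda>x. f x H)" for H
    using f unfolding finitary_map_def continuous_map_componentwise_UNIV by blast
  then have "continuous_map T euclideanreal (\<lambda>x. \<Sum>H\<in>{H \<in> F. Q H}. f x H)"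
    using F(1) by (intro continuous_map_sum) auto
  then show ?thesis
    by (rule continuous_map_eq) (use mass_sum_eq[OF F(1) F(2)] in simp)
qed

lemma complement_mass_nonneg:
  assumes "a \<in> realization_points P (\<subseteq>)" shows "0 \<le> complement_mass a i"
  unfolding complement_mass_def using realization_points_memD(1)[OF assms] by (intro sum_nonneg)

lemma free_mass_nonneg:
  assumes "a \<in> realization_points P (\<subseteq>)" shows "0 \<le> free_mass a"
  unfolding free_mass_def using realization_points_memD(1)[OF assms] by (intro sum_nonneg)

text \<open>No member of the support complements two different members of the chain, so the
  complements of the single \<open>N i\<close> and the remaining subgroups partition the
  support.\<close>

lemma mass_total:
  assumes a: "a \<in> realization_points P (\<subseteq>)"
    and J': "finite J'" "J' \<subseteq> J" "\<And>i. i \<in> J - J' \<Longrightarrow> complement_mass a i = 0"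
  shows "free_mass a + (\<Sum>i\<in>J'. complement_mass a i) = 1"
proof -
  note aD = realization_points_memD[OF a]
  let ?S = "{H. a H \<noteq> 0}"
  let ?C = "\<lambda>i. {H. a H \<noteq> 0 \<and> complementary G H (N i)}"
  let ?D = "{H. a H \<noteq> 0 \<and> (\<forall>i\<in>J. \<not> complementary G H (N i))}"
  have finC: "finite (?C i)" for i by (rule finite_subset[OF _ aD(3)]) blast
  have finD: "finite ?D" by (rule finite_subset[OF _ aD(3)]) blast
  have none: "i \<in> J'" if "i \<in> J" "a H \<noteq> 0" "complementary G H (N i)" for i H
  proof (rule ccontr)
    assume "i \<notin> J'"
    then have "(\<Sum>H\<in>?C i. a H) = 0" using J'(3)[of i] that(1) unfolding complement_mass_def by blast
    then have "\<forall>H\<in>?C i. a H = 0" using sum_nonneg_eq_0_iff[OF finC, where f = a] aD(1) by blast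
    then show False using that by blast
  qed
  have "?S = ?D \<union> (\<Union>i\<in>J'. ?C i)" using none J'(2) by blast
  then have "1 = (\<Sum>H\<in>?D \<union> (\<Union>i\<in>J'. ?C i). a H)" using aD(5) by (simp only:)
  also have "\<dots> = (\<Sum>H\<in>?D. a H) + (\<Sum>H\<in>(\<Union>i\<in>J'. ?C i). a H)"
    using J'(2) by (intro sum.union_disjoint finD finite_UN_I J'(1) finC) blast
  also have "(\<Sum>H\<in>(\<Union>i\<in>J'. ?C i). a H) = (\<Sum>i\<in>J'. \<Sum>H\<in>?C i. a H)"
  proof (rule sum.UNION_disjoint[OF J'(1)])
    show "\<forall>i\<in>J'. finite (?C i)" using finC by blast
    show "\<forall>i\<in>J'. \<forall>j\<in>J'. i \<noteq> j \<longrightarrow> ?C i \<inter> ?C j = {}"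
      using complement_index_unique aD(2) J'(2) by blast
  qed
  finally show ?thesis unfolding free_mass_def complement_mass_def by simp
qed

text \<open>A complement of \<open>N i\<close> has \<open>c i\<close> as its only damping factor,
  and a subgroup counted by \<open>free_mass\<close> has none. This turns the survival condition
  into one about masses, which are continuous functions.\<close>

lemma exists_undamped:
  assumes a: "a \<in> realization_points P (\<subseteq>)"
    and "free_mass a \<noteq> 0 \<or> (\<exists>i\<in>J. complement_mass a i \<noteq> 0 \<and> c i \<noteq> 0)"
  shows "\<exists>H. a H \<noteq> 0 \<and> (\<forall>i\<in>J. complementary G H (N i) \<longrightarrow> c i \<noteq> 0)"
  using assms(2)
proof
  assume "free_mass a \<noteq> 0"
  then have "{H. a H \<noteq> 0 \<and> (\<forall>i\<in>J. \<not> complementary G H (N i))} \<noteq> {}"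
    unfolding free_mass_def by (metis sum.empty)
  then show ?thesis by blast
next
  assume "\<exists>i\<in>J. complement_mass a i \<noteq> 0 \<and> c i \<noteq> 0"
  then obtain i where i: "i \<in> J" "complement_mass a i \<noteq> 0" "c i \<noteq> 0" by blast
  then have "{H. a H \<noteq> 0 \<and> complementary G H (N i)} \<noteq> {}"
    unfolding complement_mass_def by (metis sum.empty)
  then obtain H where H: "a H \<noteq> 0" "complementary G H (N i)" by blast
  then have "H \<in> P" using realization_points_memD(2)[OF a] by blast
  then have "\<forall>j\<in>J. complementary G H (N j) \<longrightarrow> j = i"
    using complement_index_unique i(1) H(2) by blast
  then show ?thesis using H(1) i(3) by blast
qed

end

section \<open>Maps from a sphere into a simplex of larger dimension\<close>

abbreviation sphere_dist :: "nat \<Rightarrow> (nat \<Rightarrow> real) \<Rightarrow> (nat \<Rightarrow> real) \<Rightarrow> real" where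
  "sphere_dist k x y \<equiv> (\<Sum>i\<le>k. \<bar>x i - y i\<bar>)"

lemma topspace_nsphere_iff:
  "x \<in> topspace (nsphere k) \<longleftrightarrow> (\<Sum>i\<le>k. (x i)\<^sup>2) = 1 \<and> (\<forall>i>k. x i = 0)"
  by (auto simp: nsphere)

lemma nsphere_coordinate_le_1:
  assumes "x \<in> topspace (nsphere k)"
  shows "\<bar>x i\<bar> \<le> 1"
proof (cases "i \<le> k")
  case True
  have "(x i)\<^sup>2 \<le> (\<Sum>i\<le>k. (x i)\<^sup>2)" using True by (intro member_le_sum) auto
  then have "(x i)\<^sup>2 \<le> 1" using assms by (simp add: topspace_nsphere_iff)
  then show ?thesis by (simp add: abs_square_le_1)
next
  case False
  then show ?thesis using assms by (simp add: topspace_nsphere_iff)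
qed

lemma compact_topspace_nsphere: "compact (topspace (nsphere k))"
proof -
  have "compactin (powertop_real UNIV) (\<Pi>\<^sub>E i\<in>(UNIV::nat set). {-1..1::real})"
    by (simp add: compactin_PiE)
  then have c: "compact (\<Pi>\<^sub>E i\<in>(UNIV::nat set). {-1..1::real})"
    by (simp only: euclidean_product_topology compactin_euclidean_iff)
  have cc: "continuous_on UNIV (\<lambda>a::nat \<Rightarrow> real. a x)" for x
    by (rule continuous_on_product_then_coordinatewise) (rule continuous_on_id)
  have "topspace (nsphere k) = {x. (\<Sum>i\<le>k. (x i)\<^sup>2) = 1 \<and> (\<forall>i. k < i \<longrightarrow> x i = 0)}"
    using topspace_nsphere_iff by blast
  moreover have "closed {x::nat \<Rightarrow> real. (\<Sum>i\<le>k. (x i)\<^sup>2) = 1 \<and> (\<forall>i. k < i \<longrightarrow> x i = 0)}"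
    by (intro closed_Collect_conj closed_Collect_all closed_Collect_imp
        closed_Collect_eq continuous_intros cc) auto
  ultimately have "closed (topspace (nsphere k))" by simp
  moreover have "topspace (nsphere k) \<subseteq> (\<Pi>\<^sub>E i\<in>(UNIV::nat set). {-1..1::real})"
  proof
    fix x assume "x \<in> topspace (nsphere k)"
    then have "\<bar>x i\<bar> \<le> 1" for i using nsphere_coordinate_le_1 by blast
    then have "x i \<in> {-1..1}" for i by (simp add: abs_le_iff minus_le_iff)
    then show "x \<in> (\<Pi>\<^sub>E i\<in>(UNIV::nat set). {-1..1::real})" by (simp add: PiE_UNIV_domain)
  qed
  ultimately show ?thesis using c closed_Int_compact by (metis inf.absorb1)
qed

lemma compact_space_nsphere: "compact_space (nsphere k)"
proof -
  have "nsphere k = subtopology euclidean (topspace (nsphere k))"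
    unfolding nsphere euclidean_product_topology by simp
  then show ?thesis using compact_topspace_nsphere by (metis compact_space_subtopology compactin_euclidean_iff)
qed

section \<open>Lipschitz functions on the sphere and the directions they miss\<close>

definition sphere_lipschitz :: "nat \<Rightarrow> ((nat \<Rightarrow> real) \<Rightarrow> real) \<Rightarrow> bool" where
  "sphere_lipschitz k h \<longleftrightarrow> (\<exists>L. \<forall>x\<in>topspace (nsphere k). \<forall>y\<in>topspace (nsphere k).
     \<bar>h x - h y\<bar> \<le> L * sphere_dist k x y)"

text \<open>Lipschitz functions on the compact sphere form an algebra (products are Lipschitz
  because the factors are bounded) that contains the constants and, through the coordinates,
  separates points; so Stone-Weierstrass applies.\<close>

lemma sphere_lipschitz_approximation:
  assumes c: "continuous_map (nsphere k) euclideanreal c" and e: "0 < e"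
  shows "\<exists>q. continuous_map (nsphere k) euclideanreal q \<and> sphere_lipschitz k q \<and>
    (\<forall>x\<in>topspace (nsphere k). \<bar>c x - q x\<bar> < e)"
proof -
  let ?S = "topspace (nsphere k)"
  have nS: "nsphere k = subtopology euclidean ?S"
    unfolding nsphere euclidean_product_topology by simp
  have cm: "continuous_map (nsphere k) euclideanreal h \<longleftrightarrow> continuous_on ?S h" for h
    by (subst nS) (simp only: continuous_map_iff_continuous)
  define R where "R = {h. continuous_on ?S h \<and> sphere_lipschitz k h}"
  interpret function_ring_on R ?S
  proof
    show "compact ?S" by (rule compact_topspace_nsphere)
    show "continuous_on ?S f" if "f \<in> R" for f using that by (simp add: R_def)
  next
    fix f g assume f: "f \<in> R" and g: "g \<in> R"
    obtain L where L: "\<And>x y. x \<in> ?S \<Longrightarrow> y \<in> ?S \<Longrightarrow> \<bar>f x - f y\<bar> \<le> L * sphere_dist k x y"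
      using f unfolding R_def sphere_lipschitz_def by blast
    obtain L' where L': "\<And>x y. x \<in> ?S \<Longrightarrow> y \<in> ?S \<Longrightarrow> \<bar>g x - g y\<bar> \<le> L' * sphere_dist k x y"
      using g unfolding R_def sphere_lipschitz_def by blast
    have "\<bar>(f x + g x) - (f y + g y)\<bar> \<le> (L + L') * sphere_dist k x y" if "x \<in> ?S" "y \<in> ?S" for x y
      using L[OF that] L'[OF that] by (simp add: distrib_right)
    then have "sphere_lipschitz k (\<lambda>x. f x + g x)" unfolding sphere_lipschitz_def by blast
    then show "(\<lambda>x. f x + g x) \<in> R" using f g by (auto simp: R_def intro: continuous_on_add)
    have "bounded (f ` ?S)" "bounded (g ` ?S)"
      using f g compact_topspace_nsphere compact_continuous_image compact_imp_bounded
      unfolding R_def by blast+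
    then obtain B B' where B: "\<And>x. x \<in> ?S \<Longrightarrow> \<bar>f x\<bar> \<le> B" "\<And>x. x \<in> ?S \<Longrightarrow> \<bar>g x\<bar> \<le> B'"
      unfolding bounded_iff by auto
    have "\<bar>f x * g x - f y * g y\<bar> \<le> (B * L' + B' * L) * sphere_dist k x y"
      if xy: "x \<in> ?S" "y \<in> ?S" for x y
    proof -
      have B0: "0 \<le> B" "0 \<le> B'" using B[OF xy(1)] by linarith+
      have "f x * g x - f y * g y = f x * (g x - g y) + g y * (f x - f y)"
        by (simp add: algebra_simps)
      then have "\<bar>f x * g x - f y * g y\<bar> \<le> \<bar>f x\<bar> * \<bar>g x - g y\<bar> + \<bar>g y\<bar> * \<bar>f x - f y\<bar>"
        by (metis abs_mult abs_triangle_ineq)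
      also have "\<dots> \<le> B * (L' * sphere_dist k x y) + B' * (L * sphere_dist k x y)"
        using B[OF xy(1)] B[OF xy(2)] L[OF xy] L'[OF xy] B0
        by (intro add_mono mult_mono) auto
      finally show ?thesis by (simp add: algebra_simps)
    qed
    then have "sphere_lipschitz k (\<lambda>x. f x * g x)" unfolding sphere_lipschitz_def by blast
    then show "(\<lambda>x. f x * g x) \<in> R" using f g by (auto simp: R_def intro: continuous_on_mult)
  next
    have "sphere_lipschitz k (\<lambda>_. b)" for b
      unfolding sphere_lipschitz_def by (intro exI[of _ 0]) simp
    then show "(\<lambda>_. b) \<in> R" for b by (simp add: R_def)
  next
    fix x y assume xy: "x \<in> ?S" "y \<in> ?S" "x \<noteq> y"
    then obtain i where i: "x i \<noteq> y i" by blast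
    then have ik: "i \<le> k" using xy by (metis topspace_nsphere_iff not_le)
    have "\<bar>x i - y i\<bar> \<le> 1 * sphere_dist k x y" for x y :: "nat \<Rightarrow> real"
      using ik member_le_sum[of i "{..k}" "\<lambda>i. \<bar>x i - y i\<bar>"] by simp
    then have "sphere_lipschitz k (\<lambda>x. x i)" unfolding sphere_lipschitz_def by blast
    moreover have "continuous_on ?S (\<lambda>x. x i)"
      using continuous_map_nsphere_projection[of k i] cm by blast
    ultimately have "(\<lambda>x. x i) \<in> R" by (simp add: R_def)
    then show "\<exists>f\<in>R. f x \<noteq> f y" using i by (intro bexI[of _ "\<lambda>x. x i"])
  qed
  show ?thesis using Stone_Weierstrass_basic[of c e] c e cm unfolding R_def by blast
qed

text \<open>On the sphere a coordinate of maximal modulus is determined, up to sign, by the others, and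
  depends on them in a Lipschitz way; so the sphere falls into \<open>O(n\<^sup>k)\<close> pieces of diameter
  \<open>O(1/n)\<close>.\<close>

lemma nsphere_same_cell_close:
  fixes n :: real
  assumes x: "x \<in> topspace (nsphere k)" and y: "y \<in> topspace (nsphere k)"
    and i: "i \<le> k" and mx: "\<And>j. j \<le> k \<Longrightarrow> \<bar>x j\<bar> \<le> \<bar>x i\<bar>" and my: "\<And>j. j \<le> k \<Longrightarrow> \<bar>y j\<bar> \<le> \<bar>y i\<bar>"
    and sgn: "0 < x i \<longleftrightarrow> 0 < y i" and n: "0 < n"
    and fl: "\<And>j. j \<le> k \<Longrightarrow> j \<noteq> i \<Longrightarrow> \<lfloor>n * x j\<rfloor> = \<lfloor>n * y j\<rfloor>"
  shows "sphere_dist k x y \<le> 2 * real (k + 1) / n"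
proof -
  let ?I = "{..k} - {i}"
  have d: "\<bar>x j - y j\<bar> \<le> 1 / n" if "j \<in> ?I" for j
  proof -
    have "\<lfloor>n * x j\<rfloor> = \<lfloor>n * y j\<rfloor>" using fl[of j] that by blast
    then have "\<bar>n * x j - n * y j\<bar> \<le> 1" by linarith
    then have "n * \<bar>x j - y j\<bar> \<le> 1" using n by (simp add: abs_mult flip: right_diff_distrib)
    then show ?thesis using n by (simp add: pos_le_divide_eq mult.commute)
  qed
  have sx: "(x i)\<^sup>2 + (\<Sum>j\<in>?I. (x j)\<^sup>2) = 1" and sy: "(y i)\<^sup>2 + (\<Sum>j\<in>?I. (y j)\<^sup>2) = 1"
    using x y i sum.remove[of "{..k}" i "\<lambda>j. (x j)\<^sup>2"] sum.remove[of "{..k}" i "\<lambda>j. (y j)\<^sup>2"]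
    by (simp_all add: topspace_nsphere_iff)
  have xi: "x i \<noteq> 0"
  proof
    assume 0: "x i = 0"
    then have "x j = 0" if "j \<in> {..k}" for j using mx[of j] that by simp
    then have "(\<Sum>j\<le>k. (x j)\<^sup>2) = 0" by simp
    then show False using x by (simp add: topspace_nsphere_iff)
  qed
  have add: "\<bar>x i + y i\<bar> = \<bar>x i\<bar> + \<bar>y i\<bar>" using sgn by linarith
  have pos: "0 < \<bar>x i\<bar> + \<bar>y i\<bar>" using xi by linarith
  \<comment> \<open>Both points have norm 1, so the difference of the squares of coordinate
    \<open>i\<close> is paid for by the other coordinates. Equal signs and maximality put the same
    factor \<open>\<bar>x i\<bar> + \<bar>y i\<bar>\<close> on both sides, and it cancels.\<close>
  have "\<bar>x i - y i\<bar> * (\<bar>x i\<bar> + \<bar>y i\<bar>) = \<bar>(x i - y i) * (x i + y i)\<bar>"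
    by (simp add: abs_mult add)
  also have "(x i - y i) * (x i + y i) = (x i)\<^sup>2 - (y i)\<^sup>2"
    by (simp add: power2_eq_square algebra_simps)
  also have "\<dots> = (\<Sum>j\<in>?I. (y j)\<^sup>2 - (x j)\<^sup>2)"
    using sx sy by (simp add: sum_subtractf)
  also have "\<bar>\<dots>\<bar> \<le> (\<Sum>j\<in>?I. \<bar>(y j)\<^sup>2 - (x j)\<^sup>2\<bar>)" by (rule sum_abs)
  also have "\<dots> \<le> (\<Sum>j\<in>?I. \<bar>x j - y j\<bar> * (\<bar>x i\<bar> + \<bar>y i\<bar>))"
  proof (rule sum_mono)
    fix j assume j: "j \<in> ?I"
    have "\<bar>(y j)\<^sup>2 - (x j)\<^sup>2\<bar> = \<bar>(x j - y j) * (x j + y j)\<bar>"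
      by (simp add: power2_eq_square algebra_simps abs_minus_commute)
    also have "\<dots> = \<bar>x j - y j\<bar> * \<bar>x j + y j\<bar>" by (rule abs_mult)
    also have "\<dots> \<le> \<bar>x j - y j\<bar> * (\<bar>x i\<bar> + \<bar>y i\<bar>)"
      using mx[of j] my[of j] j abs_triangle_ineq[of "x j" "y j"] by (intro mult_left_mono) auto
    finally show "\<bar>(y j)\<^sup>2 - (x j)\<^sup>2\<bar> \<le> \<bar>x j - y j\<bar> * (\<bar>x i\<bar> + \<bar>y i\<bar>)" .
  qed
  also have "\<dots> = (\<Sum>j\<in>?I. \<bar>x j - y j\<bar>) * (\<bar>x i\<bar> + \<bar>y i\<bar>)" by (simp add: sum_distrib_right)
  finally have "\<bar>x i - y i\<bar> \<le> (\<Sum>j\<in>?I. \<bar>x j - y j\<bar>)"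
    using pos by simp
  moreover have "sphere_dist k x y = \<bar>x i - y i\<bar> + (\<Sum>j\<in>?I. \<bar>x j - y j\<bar>)"
    using i by (intro sum.remove) auto
  moreover have "(\<Sum>j\<in>?I. \<bar>x j - y j\<bar>) \<le> real (card ?I) * (1 / n)"
    using d by (rule sum_bounded_above)
  moreover have "real (card ?I) * (1 / n) \<le> real (k + 1) / n"
    using i n by (simp add: divide_right_mono)
  moreover have "2 * real (k + 1) / n = real (k + 1) / n + real (k + 1) / n" by simp
  ultimately show ?thesis by linarith
qed

text \<open>A Lipschitz image of the \<open>k\<close>-sphere misses a direction in \<open>\<real>\<^sup>m\<close> for \<open>m \<ge> k + 2\<close>:
  a grid of \<open>s ^ (m - 1)\<close> directions cannot be hit by the \<open>O(s\<^sup>k)\<close> small pieces of the sphere.\<close>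

lemma sphere_lipschitz_misses_direction:
  fixes g :: "nat \<Rightarrow> (nat \<Rightarrow> real) \<Rightarrow> real"
  assumes m: "k + 2 \<le> m" and lip: "\<And>i. i < m \<Longrightarrow> sphere_lipschitz k (g i)"
    and d: "0 < d" and A: "A \<subseteq> topspace (nsphere k)"
    and big: "\<And>x. x \<in> A \<Longrightarrow> \<exists>i<m. d \<le> g i x"
  shows "\<exists>p. (\<forall>i<m. 0 < p i) \<and> (\<forall>x\<in>A. \<forall>l. \<exists>i<m. g i x \<noteq> l * p i)"
proof (rule ccontr)
  assume neg: "\<not> ?thesis"
  let ?S = "topspace (nsphere k)"
  have "\<exists>L. \<forall>x\<in>?S. \<forall>y\<in>?S. \<bar>g i x - g i y\<bar> \<le> L * sphere_dist k x y" if "i < m" for i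
    using lip[OF that] unfolding sphere_lipschitz_def .
  then obtain Li where Li: "\<And>i x y. i < m \<Longrightarrow> x \<in> ?S \<Longrightarrow> y \<in> ?S \<Longrightarrow>
      \<bar>g i x - g i y\<bar> \<le> Li i * sphere_dist k x y" by metis
  define L where "L = (\<Sum>i<m. \<bar>Li i\<bar>)"
  have L: "\<bar>g i x - g i y\<bar> \<le> L * sphere_dist k x y" if "i < m" "x \<in> ?S" "y \<in> ?S" for i x y
  proof -
    have "Li i \<le> L" unfolding L_def
      using member_le_sum[of i "{..<m}" "\<lambda>i. \<bar>Li i\<bar>"] that(1) by simp
    then have "Li i * sphere_dist k x y \<le> L * sphere_dist k x y"
      by (intro mult_right_mono sum_nonneg) auto
    then show ?thesis using Li[OF that] by linarith
  qed
  \<comment> \<open>\<open>C\<close> is the fineness of the cells relative to the grid: with mesh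
    \<open>1 / (C * s)\<close> the values of \<open>g\<close> on one cell vary too little to bridge
    the gap \<open>d / s\<close> between different grid directions.\<close>
  obtain C0 :: nat where C0: "4 * L * real (k + 1) / d < real C0" using reals_Archimedean2 by blast
  define C where "C = Suc C0"
  have C: "4 * L * real (k + 1) < real C * d" "1 \<le> C"
    using C0 d by (auto simp: C_def pos_divide_less_eq distrib_right)
  \<comment> \<open>There are at most \<open>2 * (k + 1) * (3 * C * s) ^ k\<close> cells. This
    \<open>s\<close> is just large enough to make that number smaller than
    \<open>s ^ (k + 1)\<close>.\<close>
  define s where "s = 2 * (k + 1) * (3 * C) ^ k + 1"
  define n where "n = C * s"
  have s1: "1 \<le> s" by (simp add: s_def)
  have n1: "1 \<le> n" using C(2) s1 unfolding n_def by (metis mult_le_mono nat_mult_1)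
  define Q where "Q = (\<Pi>\<^sub>E i\<in>{1..<m}. {1..s})"
  \<comment> \<open>Coordinate 0 is normalized to 1, so the multiple \<open>l q\<close> can be read
    off it; the other \<open>m - 1\<close> coordinates range over the grid of multiples of
    \<open>1 / s\<close> in (0,1].\<close>
  define p where "p q i = (if i = 0 then 1 else real (q i) / real s)" for q :: "nat \<Rightarrow> nat" and i
  have p: "0 < p q i" "p q i \<le> 1" if "q \<in> Q" "i < m" for q i
  proof -
    have "q i \<in> {1..s}" if "i \<noteq> 0"
      using PiE_mem[OF \<open>q \<in> Q\<close>[unfolded Q_def], of i] \<open>i < m\<close> that by simp
    then show "0 < p q i" "p q i \<le> 1" using s1 by (auto simp: p_def)
  qed
  have "\<exists>x l. x \<in> A \<and> (\<forall>i<m. g i x = l * p q i)" if "q \<in> Q" for q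
    using neg p[OF that] by blast
  then obtain \<xi> l where \<xi>: "\<And>q. q \<in> Q \<Longrightarrow> \<xi> q \<in> A"
    and l: "\<And>q i. q \<in> Q \<Longrightarrow> i < m \<Longrightarrow> g i (\<xi> q) = l q * p q i" by metis
  have \<xi>S: "\<xi> q \<in> ?S" if "q \<in> Q" for q using \<xi>[OF that] A by blast
  \<comment> \<open>All coordinates of a direction are at most 1 while some value of
    \<open>g\<close> is at least \<open>d\<close>, so the ray is hit far out, where different
    directions are well separated.\<close>
  have ld: "d \<le> l q" if q: "q \<in> Q" for q
  proof -
    obtain i where i: "i < m" "d \<le> l q * p q i" using big[OF \<xi>[OF q]] l[OF q] by auto
    then have "0 < l q * p q i" using d by linarith
    then have "0 < l q" using p(1)[OF q i(1)] by (simp add: zero_less_mult_iff)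
    then have "l q * p q i \<le> l q" using p(2)[OF q i(1)] by simp
    then show ?thesis using i(2) by linarith
  qed
  have "\<exists>i. i \<le> k \<and> (\<forall>j\<le>k. \<bar>x j\<bar> \<le> \<bar>x i\<bar>)" for x :: "nat \<Rightarrow> real"
    using Max_in[of "(\<lambda>j. \<bar>x j\<bar>) ` {..k}"] Max_ge[of "(\<lambda>j. \<bar>x j\<bar>) ` {..k}"] by fastforce
  then obtain top where top: "\<And>x::nat \<Rightarrow> real. top x \<le> k"
    "\<And>(x::nat \<Rightarrow> real) j. j \<le> k \<Longrightarrow> \<bar>x j\<bar> \<le> \<bar>x (top x)\<bar>" by metis
  \<comment> \<open>The cell of a point: the position of a coordinate of maximal modulus, its sign,
    and the rounded values of the other \<open>k\<close> coordinates.\<close>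
  define key where "key x = (top x, 0 < x (top x), \<lambda>j\<in>{..k} - {top x}. \<lfloor>real n * x j\<rfloor>)"
    for x :: "nat \<Rightarrow> real"
  let ?K = "SIGMA i:{..k}. (UNIV :: bool set) \<times> (\<Pi>\<^sub>E j\<in>{..k} - {i}. {- int n..int n})"
  have "key x \<in> ?K" if "x \<in> ?S" for x
  proof -
    have "\<lfloor>real n * x j\<rfloor> \<in> {- int n..int n}" for j
    proof -
      have "\<bar>real n * x j\<bar> \<le> real n"
        using nsphere_coordinate_le_1[OF that, of j] by (simp add: abs_mult mult_left_le)
      then have "- real n \<le> real n * x j" "real n * x j \<le> real n" by linarith+
      then show ?thesis by (auto simp: le_floor_iff floor_le_iff)
    qed
    then show ?thesis unfolding key_def using top(1) by auto
  qed
  then have sub: "(\<lambda>q. key (\<xi> q)) ` Q \<subseteq> ?K" using \<xi>S by blast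
  have cardK: "card ?K = (k + 1) * (2 * (2 * n + 1) ^ k)"
  proof -
    have "card ((UNIV :: bool set) \<times> (\<Pi>\<^sub>E j\<in>{..k} - {i}. {- int n..int n})) = 2 * (2 * n + 1) ^ k"
      if "i \<in> {..k}" for i
    proof -
      have "nat (int n + 1 + int n) = 2 * n + 1" by simp
      then show ?thesis using that
        by (simp add: card_cartesian_product card_PiE card_Diff_singleton)
    qed
    moreover have "finite ((UNIV :: bool set) \<times> (\<Pi>\<^sub>E j\<in>{..k} - {i}. {- int n..int n}))" for i
      by (intro finite_cartesian_product finite_PiE) simp_all
    ultimately show ?thesis by (subst card_SigmaI) simp_all
  qed
  have cardQ: "card Q = s ^ (m - 1)" unfolding Q_def by (simp add: card_PiE)
  have "2 * n + 1 \<le> 3 * C * s" using n1 unfolding n_def by simp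
  then have "(2 * n + 1) ^ k \<le> (3 * C * s) ^ k" by (rule power_mono) simp
  then have "card ?K \<le> (k + 1) * (2 * (3 * C * s) ^ k)" unfolding cardK by (intro mult_le_mono order_refl)
  also have "\<dots> = (2 * (k + 1) * (3 * C) ^ k) * s ^ k"
    by (simp only: power_mult_distrib ac_simps)
  also have "\<dots> < s * s ^ k"
  proof (rule mult_strict_right_mono)
    show "2 * (k + 1) * (3 * C) ^ k < s" unfolding s_def by linarith
    show "0 < s ^ k" using s1 by (intro zero_less_power) linarith
  qed
  also have "\<dots> = s ^ (k + 1)" by simp
  also have "\<dots> \<le> s ^ (m - 1)" using m s1 by (intro power_increasing) auto
  finally have "card ?K < card Q" using cardQ by simp
  moreover have "finite ?K"
    by (intro finite_SigmaI finite_cartesian_product finite_PiE) simp_all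
  ultimately have "\<not> inj_on (\<lambda>q. key (\<xi> q)) Q" using card_inj_on_le[OF _ sub] by fastforce
  then obtain q r where qr: "q \<in> Q" "r \<in> Q" "key (\<xi> q) = key (\<xi> r)" "q \<noteq> r"
    unfolding inj_on_def by blast
  have "sphere_dist k (\<xi> q) (\<xi> r) \<le> 2 * real (k + 1) / real n"
  proof (rule nsphere_same_cell_close[OF \<xi>S[OF qr(1)] \<xi>S[OF qr(2)] top(1) top(2)])
    have t: "top (\<xi> r) = top (\<xi> q)" using qr(3) by (simp add: key_def)
    show "\<bar>\<xi> r j\<bar> \<le> \<bar>\<xi> r (top (\<xi> q))\<bar>" if "j \<le> k" for j
      using top(2)[OF that, of "\<xi> r"] t by simp
    show "(0 < \<xi> q (top (\<xi> q))) = (0 < \<xi> r (top (\<xi> q)))" using qr(3) t by (simp add: key_def)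
    show "0 < real n" using n1 by simp
    fix j assume j: "j \<le> k" "j \<noteq> top (\<xi> q)"
    have "(\<lambda>j\<in>{..k} - {top (\<xi> q)}. \<lfloor>real n * \<xi> q j\<rfloor>) =
        (\<lambda>j\<in>{..k} - {top (\<xi> q)}. \<lfloor>real n * \<xi> r j\<rfloor>)" using qr(3) t by (simp add: key_def)
    from fun_cong[OF this, of j] show "\<lfloor>real n * \<xi> q j\<rfloor> = \<lfloor>real n * \<xi> r j\<rfloor>"
      using j by simp
  qed
  define e where "e = L * (2 * real (k + 1) / real n)"
  have "0 \<le> L" unfolding L_def by (simp add: sum_nonneg)
  then have close: "\<bar>g i (\<xi> q) - g i (\<xi> r)\<bar> \<le> e" if "i < m" for i
    using L[OF that \<xi>S[OF qr(1)] \<xi>S[OF qr(2)]]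
      mult_left_mono[OF \<open>sphere_dist k (\<xi> q) (\<xi> r) \<le> 2 * real (k + 1) / real n\<close>, of L]
    unfolding e_def by linarith
  have "\<bar>l q - l r\<bar> \<le> e" using close[of 0] l[OF qr(1), of 0] l[OF qr(2), of 0] m by (simp add: p_def)
  obtain j where j: "j \<in> {1..<m}" "q j \<noteq> r j"
    using qr(1,2,4) PiE_ext unfolding Q_def by blast
  have jm: "j < m" "j \<noteq> 0" using j(1) by auto
  have "1 \<le> \<bar>real (q j) - real (r j)\<bar>" using j(2) by linarith
  then have "1 / real s \<le> \<bar>real (q j) - real (r j)\<bar> / real s" by (intro divide_right_mono) auto
  also have "\<dots> = \<bar>p q j - p r j\<bar>"
    using jm(2) s1 by (simp add: p_def abs_divide flip: diff_divide_distrib)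
  finally have gap: "1 / real s \<le> \<bar>p q j - p r j\<bar>" .
  \<comment> \<open>Two directions hit from the same cell differ in coordinate \<open>j\<close>.
    That difference, scaled by \<open>l q\<close>, is at least \<open>d / s\<close>, yet it is
    bounded by the variation of \<open>g j\<close> plus that of \<open>l\<close>, each at most
    \<open>e\<close>.\<close>
  have "d / real s = d * (1 / real s)" by simp
  also have "\<dots> \<le> l q * \<bar>p q j - p r j\<bar>" using gap ld[OF qr(1)] d by (intro mult_mono) auto
  also have "\<dots> = \<bar>l q * (p q j - p r j)\<bar>" using ld[OF qr(1)] d by (simp add: abs_mult)
  also have "l q * (p q j - p r j) = (g j (\<xi> q) - g j (\<xi> r)) - (l q - l r) * p r j"
    using l[OF qr(1) jm(1)] l[OF qr(2) jm(1)] by (simp add: algebra_simps)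
  also have "\<bar>\<dots>\<bar> \<le> \<bar>g j (\<xi> q) - g j (\<xi> r)\<bar> + \<bar>(l q - l r) * p r j\<bar>" by (rule abs_triangle_ineq4)
  also have "\<dots> \<le> e + e"
  proof (rule add_mono[OF close[OF jm(1)]])
    have "\<bar>(l q - l r) * p r j\<bar> = \<bar>l q - l r\<bar> * p r j"
      using p(1)[OF qr(2) jm(1)] by (simp add: abs_mult)
    also have "\<dots> \<le> \<bar>l q - l r\<bar>" using p[OF qr(2) jm(1)] by (simp add: mult_left_le)
    finally show "\<bar>(l q - l r) * p r j\<bar> \<le> e" using \<open>\<bar>l q - l r\<bar> \<le> e\<close> by linarith
  qed
  also have "e + e = 4 * L * real (k + 1) / (real C * real s)"
    by (simp add: e_def n_def algebra_simps flip: add_divide_distrib)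
  finally have "d / real s \<le> 4 * L * real (k + 1) / (real C * real s)" .
  then have "d \<le> 4 * L * real (k + 1) / real C"
    using s1 C(2) by (simp add: field_simps)
  then show False using C by (simp add: field_simps)
qed

lemma continuous_map_Min:
  assumes "finite I" "I \<noteq> {}" "\<And>i. i \<in> I \<Longrightarrow> continuous_map T euclideanreal (h i)"
  shows "continuous_map T euclideanreal (\<lambda>x. Min ((\<lambda>i. h i x) ` I))"
  using assms
proof (induction I rule: finite_ne_induct)
  case (insert i I)
  then have "continuous_map T euclideanreal (\<lambda>x. min (h i x) (Min ((\<lambda>i. h i x) ` I)))"
    by (intro continuous_map_real_min) auto
  then show ?case using insert by simp
qed simp

text \<open>Subtracting a multiple of a missed direction from a Lipschitz approximation of \<open>c\<close> leaves
  a nonzero vector with a vanishing coordinate; \<open>u\<close> is supported near the vanishing coordinates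
  and \<open>v\<close> away from them.\<close>

lemma nsphere_vanishing_coordinates:
  fixes c :: "nat \<Rightarrow> (nat \<Rightarrow> real) \<Rightarrow> real"
  assumes m: "k + 2 \<le> m"
    and c: "\<And>i. i < m \<Longrightarrow> continuous_map (nsphere k) euclideanreal (c i)"
    and r: "continuous_map (nsphere k) euclideanreal r"
    and c0: "\<And>i x. i < m \<Longrightarrow> x \<in> topspace (nsphere k) \<Longrightarrow> 0 \<le> c i x"
    and r0: "\<And>x. x \<in> topspace (nsphere k) \<Longrightarrow> 0 \<le> r x"
    and total: "\<And>x. x \<in> topspace (nsphere k) \<Longrightarrow> r x + (\<Sum>i<m. c i x) = 1"
  obtains u v :: "nat \<Rightarrow> (nat \<Rightarrow> real) \<Rightarrow> real"
  where "\<And>i. i < m \<Longrightarrow> continuous_map (nsphere k) euclideanreal (u i)"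
    and "\<And>i. i < m \<Longrightarrow> continuous_map (nsphere k) euclideanreal (v i)"
    and "\<And>i x. 0 \<le> u i x" and "\<And>i x. 0 \<le> v i x" and "\<And>i x. u i x = 0 \<or> v i x = 0"
    and "\<And>x. x \<in> topspace (nsphere k) \<Longrightarrow> \<exists>i<m. u i x \<noteq> 0"
    and "\<And>x. x \<in> topspace (nsphere k) \<Longrightarrow> r x \<noteq> 0 \<or> (\<exists>i<m. c i x \<noteq> 0 \<and> v i x \<noteq> 0)"
proof -
  let ?S = "topspace (nsphere k)"
  have ne: "{..<m} \<noteq> {}" using m by (simp add: lessThan_empty_iff)
  \<comment> \<open>If every \<open>c i x\<close> were below \<open>4 * \<delta>\<close>, their sum
    would be below 1. So where \<open>r\<close> vanishes some \<open>c i x\<close> is at least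
    \<open>4 * \<delta>\<close>, and \<open>2 * \<delta>\<close> is left after the approximation and
    the truncation.\<close>
  define \<delta> where "\<delta> = 1 / (4 * real m)"
  have \<delta>: "0 < \<delta>" using m by (simp add: \<delta>_def)
  have "\<exists>q. continuous_map (nsphere k) euclideanreal q \<and> sphere_lipschitz k q \<and>
    (\<forall>x\<in>?S. \<bar>c i x - q x\<bar> < \<delta>)" if "i < m" for i
    using sphere_lipschitz_approximation[OF c[OF that] \<delta>] .
  then obtain q where q: "\<And>i. i < m \<Longrightarrow> continuous_map (nsphere k) euclideanreal (q i)"
    "\<And>i. i < m \<Longrightarrow> sphere_lipschitz k (q i)" "\<And>i x. i < m \<Longrightarrow> x \<in> ?S \<Longrightarrow> \<bar>c i x - q i x\<bar> < \<delta>"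
    by metis
  \<comment> \<open>Subtracting \<open>\<delta>\<close> makes up for the approximation error: where
    \<open>g i\<close> is positive, \<open>c i\<close> itself is nonzero. The truncation at 0 keeps
    the Lipschitz bound.\<close>
  define g where "g i x = max 0 (q i x - \<delta>)" for i x
  have gc: "continuous_map (nsphere k) euclideanreal (g i)" if "i < m" for i
    unfolding g_def using q(1)[OF that] by (intro continuous_map_real_max continuous_map_diff) auto
  have gl: "sphere_lipschitz k (g i)" if i: "i < m" for i
  proof -
    obtain L where L: "\<And>x y. x \<in> ?S \<Longrightarrow> y \<in> ?S \<Longrightarrow> \<bar>q i x - q i y\<bar> \<le> L * sphere_dist k x y"
      using q(2)[OF i] unfolding sphere_lipschitz_def by blast
    have "\<bar>g i x - g i y\<bar> \<le> \<bar>q i x - q i y\<bar>" for x y unfolding g_def by linarith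
    then have "\<bar>g i x - g i y\<bar> \<le> L * sphere_dist k x y" if "x \<in> ?S" "y \<in> ?S" for x y
      using L[OF that] order_trans by blast
    then show ?thesis unfolding sphere_lipschitz_def by blast
  qed
  have gpos: "c i x \<noteq> 0" if "i < m" "x \<in> ?S" "0 < g i x" for i x
    using q(3)[OF that(1,2)] that(3) unfolding g_def by linarith
  have big: "\<exists>i<m. 2 * \<delta> \<le> g i x" if x: "x \<in> {x \<in> ?S. r x = 0}" for x
  proof (rule ccontr)
    assume "\<not> ?thesis"
    then have "c i x < 4 * \<delta>" if "i < m" for i
      using q(3)[of i x] x that unfolding g_def by force
    then have "(\<Sum>i<m. c i x) < (\<Sum>i<m. 4 * \<delta>)" using ne by (intro sum_strict_mono) auto
    also have "\<dots> = 1" using m by (simp add: \<delta>_def)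
    finally show False using total[of x] x by simp
  qed
  \<comment> \<open>Only points with \<open>r x = 0\<close> matter; elsewhere the free mass survives
    whatever the damping is.\<close>
  have "\<exists>p. (\<forall>i<m. 0 < p i) \<and> (\<forall>x\<in>{x \<in> ?S. r x = 0}. \<forall>l. \<exists>i<m. g i x \<noteq> l * p i)"
    by (rule sphere_lipschitz_misses_direction[OF m gl _ _ big]) (use \<delta> in auto)
  then obtain p where p: "\<And>i. i < m \<Longrightarrow> 0 < p i"
    "\<And>x l. x \<in> ?S \<Longrightarrow> r x = 0 \<Longrightarrow> \<exists>i<m. g i x \<noteq> l * p i" by blast
  \<comment> \<open>The largest multiple of \<open>p\<close> that can be subtracted from
    \<open>g\<close> without making a coordinate negative. The minimum is attained, so some
    coordinate of the difference vanishes; the difference is nonzero where \<open>g\<close> misses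
    the ray of \<open>p\<close>.\<close>
  define \<mu> where "\<mu> x = Min ((\<lambda>i. g i x / p i) ` {..<m})" for x
  have \<mu>c: "continuous_map (nsphere k) euclideanreal \<mu>"
    unfolding \<mu>_def
  proof (rule continuous_map_Min)
    show "{..<m} \<noteq> {}" by (rule ne)
    show "continuous_map (nsphere k) euclideanreal (\<lambda>x. g i x / p i)" if "i \<in> {..<m}" for i
      using gc[of i] p(1)[of i] that by (intro continuous_map_real_divide) auto
  qed simp
  define e where "e i x = g i x - p i * \<mu> x" for i x
  have ec: "continuous_map (nsphere k) euclideanreal (e i)" if "i < m" for i
    unfolding e_def using gc[OF that] \<mu>c by (intro continuous_map_diff continuous_map_real_mult) auto
  have \<mu>0: "0 \<le> \<mu> x" for x
    unfolding \<mu>_def using ne p(1) by (subst Min_ge_iff) (auto simp: g_def intro!: divide_nonneg_pos)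
  have e0: "0 \<le> e i x" if "i < m" for i x
  proof -
    have "\<mu> x \<le> g i x / p i" unfolding \<mu>_def using that by (intro Min_le) auto
    then show ?thesis using p(1)[OF that] by (simp add: e_def pos_le_divide_eq mult.commute)
  qed
  have e_le: "e i x \<le> g i x" if "i < m" for i x
    using p(1)[OF that] \<mu>0[of x] by (simp add: e_def)
  have e_zero: "\<exists>i<m. e i x = 0" for x
  proof -
    have "\<mu> x \<in> (\<lambda>i. g i x / p i) ` {..<m}" unfolding \<mu>_def using ne by (intro Min_in) auto
    then obtain i where "i < m" "\<mu> x = g i x / p i" by blast
    then show ?thesis using p(1)[of i] by (intro exI[of _ i]) (simp add: e_def)
  qed
  define M where "M x = r x + (\<Sum>i<m. e i x)" for x
  have Mc: "continuous_map (nsphere k) euclideanreal M"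
    unfolding M_def using ec r by (intro continuous_map_add continuous_map_sum) auto
  have M0: "0 < M x" if x: "x \<in> ?S" for x
  proof (cases "r x = 0")
    case False
    then have "0 < r x" using r0[OF x] by simp
    moreover have "0 \<le> (\<Sum>i<m. e i x)" using e0 by (intro sum_nonneg) auto
    ultimately show ?thesis unfolding M_def by linarith
  next
    case True
    obtain i where i: "i < m" "g i x \<noteq> \<mu> x * p i" using p(2)[OF x True] by blast
    then have "e i x \<noteq> 0" by (simp add: e_def mult.commute)
    then have "0 < e i x" using e0[OF i(1), of x] by simp
    also have "e i x \<le> (\<Sum>i<m. e i x)" using e0 i(1) by (intro member_le_sum) auto
    finally show ?thesis using True by (simp add: M_def)
  qed
  \<comment> \<open>A positive threshold below the average: where \<open>r x = 0\<close>,
    \<open>m\<close> coordinates of size at most \<open>\<theta> x\<close> could not add up to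
    \<open>M x\<close>, hence the denominator \<open>m + 1\<close>. A vanishing coordinate always
    lies below it.\<close>
  define \<theta> where "\<theta> x = M x / real (m + 1)" for x
  have \<theta>c: "continuous_map (nsphere k) euclideanreal \<theta>"
    unfolding \<theta>_def using Mc by (intro continuous_map_real_divide) auto
  show thesis
  proof (rule that[of "\<lambda>i x. max 0 (\<theta> x - e i x)" "\<lambda>i x. max 0 (e i x - \<theta> x)"])
    show "continuous_map (nsphere k) euclideanreal (\<lambda>x. max 0 (\<theta> x - e i x))"
      "continuous_map (nsphere k) euclideanreal (\<lambda>x. max 0 (e i x - \<theta> x))" if "i < m" for i
      using ec[OF that] \<theta>c by (intro continuous_map_real_max continuous_map_diff; simp)+
    show "max 0 (\<theta> x - e i x) = 0 \<or> max 0 (e i x - \<theta> x) = 0" for i x by linarith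
    fix x assume x: "x \<in> ?S"
    have \<theta>0: "0 < \<theta> x" using M0[OF x] by (simp add: \<theta>_def)
    then show "\<exists>i<m. max 0 (\<theta> x - e i x) \<noteq> 0" using e_zero[of x] by force
    show "r x \<noteq> 0 \<or> (\<exists>i<m. c i x \<noteq> 0 \<and> max 0 (e i x - \<theta> x) \<noteq> 0)"
    proof (cases "r x = 0")
      case True
      have "\<exists>i<m. \<theta> x < e i x"
      proof (rule ccontr)
        assume "\<not> ?thesis"
        then have "(\<Sum>i<m. e i x) \<le> (\<Sum>i<m. \<theta> x)" by (intro sum_mono) force
        then have "M x \<le> real m * \<theta> x" using True by (simp add: M_def)
        also have "\<dots> < real (m + 1) * \<theta> x" using \<theta>0 by simp
        also have "\<dots> = M x" by (simp add: \<theta>_def)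
        finally show False by simp
      qed
      then obtain i where i: "i < m" "\<theta> x < e i x" by blast
      then have "0 < g i x" using e_le[OF i(1), of x] \<theta>0 by linarith
      then have "c i x \<noteq> 0" using gpos[OF i(1) x] by blast
      moreover have "max 0 (e i x - \<theta> x) \<noteq> 0" using i(2) by simp
      ultimately show ?thesis using i(1) by blast
    qed simp
  qed simp_all
qed

section \<open>Null-homotopic spheres for finite chains, contractibility for infinite ones\<close>

lemma sum_half_powers: "(\<Sum>i<m. (1/2 :: real) ^ (i + 2)) = 1/2 - (1/2) ^ (m + 1)"
  by (induction m) (auto simp: field_simps)

context normal_chain
begin

lemma nullhomotopic_nsphere:
  assumes J: "J = {..<m}" and m: "k + 2 \<le> m"
    and f: "continuous_map (nsphere k) (order_complex_realization P (\<subseteq>)) f"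
  shows "\<exists>c. homotopic_with (\<lambda>_. True) (nsphere k) (order_complex_realization P (\<subseteq>)) f (\<lambda>_. c)"
proof -
  have fin: "finitary_map (nsphere k) P (\<subseteq>) f"
    using compact_continuous_imp_finitary_map[OF compact_space_nsphere f] .
  have fpt: "f x \<in> realization_points P (\<subseteq>)" if "x \<in> topspace (nsphere k)" for x
    using fin that unfolding finitary_map_def by blast
  obtain u v :: "nat \<Rightarrow> (nat \<Rightarrow> real) \<Rightarrow> real"
    where uv: "\<And>i. i < m \<Longrightarrow> continuous_map (nsphere k) euclideanreal (u i)"
      "\<And>i. i < m \<Longrightarrow> continuous_map (nsphere k) euclideanreal (v i)"
      "\<And>i x. 0 \<le> u i x" "\<And>i x. 0 \<le> v i x" "\<And>i x. u i x = 0 \<or> v i x = 0"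
      "\<And>x. x \<in> topspace (nsphere k) \<Longrightarrow> \<exists>i<m. u i x \<noteq> 0"
      "\<And>x. x \<in> topspace (nsphere k) \<Longrightarrow>
        free_mass (f x) \<noteq> 0 \<or> (\<exists>i<m. complement_mass (f x) i \<noteq> 0 \<and> v i x \<noteq> 0)"
  proof (rule nsphere_vanishing_coordinates[OF m, of "\<lambda>i x. complement_mass (f x) i" "\<lambda>x. free_mass (f x)"])
    show "continuous_map (nsphere k) euclideanreal (\<lambda>x. complement_mass (f x) i)" for i
      unfolding complement_mass_def by (rule continuous_map_mass[OF fin])
    show "continuous_map (nsphere k) euclideanreal (\<lambda>x. free_mass (f x))"
      unfolding free_mass_def by (rule continuous_map_mass[OF fin])
    fix x assume x: "x \<in> topspace (nsphere k)"
    show "0 \<le> complement_mass (f x) i" for i using complement_mass_nonneg[OF fpt[OF x]] .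
    show "0 \<le> free_mass (f x)" using free_mass_nonneg[OF fpt[OF x]] .
    show "free_mass (f x) + (\<Sum>i<m. complement_mass (f x) i) = 1"
      using mass_total[OF fpt[OF x], of "{..<m}"] unfolding J by simp
  qed (blast intro: that)
  have k0: "0 \<in> J" using m J by simp
  have data: "finitary_map (nsphere k) P (\<subseteq>) f"
    "\<And>i. i \<in> J \<Longrightarrow> continuous_map (nsphere k) euclideanreal (\<lambda>x. v i x)"
    "\<And>i. i \<in> J \<Longrightarrow> continuous_map (nsphere k) euclideanreal (\<lambda>x. u i x)"
    "\<And>x i. x \<in> topspace (nsphere k) \<Longrightarrow> i \<in> J \<Longrightarrow> 0 \<le> v i x"
    "\<And>x i. x \<in> topspace (nsphere k) \<Longrightarrow> i \<in> J \<Longrightarrow> 0 \<le> u i x"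
    "finite J" "J \<subseteq> J" "\<And>x i. x \<in> topspace (nsphere k) \<Longrightarrow> i \<in> J - J \<Longrightarrow> u i x = 0"
    "\<And>x i. x \<in> topspace (nsphere k) \<Longrightarrow> i \<in> J \<Longrightarrow> v i x = 0 \<or> u i x = 0"
    "\<And>x. x \<in> topspace (nsphere k) \<Longrightarrow> \<exists>i\<in>J. u i x \<noteq> 0"
    "\<And>x. x \<in> topspace (nsphere k) \<Longrightarrow>
      \<exists>H. f x H \<noteq> 0 \<and> (\<forall>i\<in>J. complementary G H (N i) \<longrightarrow> v i x \<noteq> 0)"
  proof -
    show "\<exists>H. f x H \<noteq> 0 \<and> (\<forall>i\<in>J. complementary G H (N i) \<longrightarrow> v i x \<noteq> 0)"
      if "x \<in> topspace (nsphere k)" for x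
      using exists_undamped[OF fpt[OF that], of "\<lambda>i. v i x"] uv(7)[OF that] unfolding J by blast
    show "v i x = 0 \<or> u i x = 0" for x i using uv(5)[of i x] by blast
    show "\<exists>i\<in>J. u i x \<noteq> 0" if "x \<in> topspace (nsphere k)" for x
      using uv(6)[OF that] unfolding J by blast
  qed (use fin uv(1-4) J in simp_all)
  note D = nullhomotopy_data[where u = "\<lambda>x i. u i x" and c = "\<lambda>x i. v i x", OF data k0]
  show ?thesis
    using homotopic_with_trans[OF homotopic_with_trans[OF
          homotopic_with_mix[OF G fin D(1) D(4)] homotopic_with_mix[OF G D(1,2) D(5)]]
        homotopic_with_mix[OF G D(2,3) D(6)]] by blast
qed

lemma finitary_map_simplex_id:
  assumes "finite C" "C \<subseteq> P" "is_chain_in (\<subseteq>) C"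
  shows "finitary_map (subtopology (powertop_real UNIV) (realization_simplex P (\<subseteq>) C)) P (\<subseteq>) (\<lambda>a. a)"
  unfolding finitary_map_def
proof (intro conjI ballI)
  show "a \<in> realization_points P (\<subseteq>)"
    if "a \<in> topspace (subtopology (powertop_real UNIV) (realization_simplex P (\<subseteq>) C))" for a
    using that realization_simplex_subset by auto
  show "\<exists>F. finite F \<and> (\<forall>a\<in>topspace (subtopology (powertop_real UNIV)
      (realization_simplex P (\<subseteq>) C)). {v. a v \<noteq> 0} \<subseteq> F)"
    using assms(1) by (intro exI[of _ C]) (simp add: realization_simplex_def)
  show "continuous_map (subtopology (powertop_real UNIV) (realization_simplex P (\<subseteq>) C))
      (powertop_real UNIV) (\<lambda>a. a)"
    by (rule continuous_map_from_subtopology) simp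
qed

text \<open>A point has finite support and each subgroup complements at most one \<open>N i\<close>,
  so some mass \<open>complement_mass a n\<close> vanishes. The first such \<open>n\<close> jumps
  from point to point; the weights \<open>u\<close> replace it by a continuous choice with finitely
  many nonzero terms on each simplex.\<close>

lemma contractible_realization:
  assumes J: "J = UNIV"
  shows "contractible_space (order_complex_realization P (\<subseteq>))"
proof -
  let ?R = "order_complex_realization P (\<subseteq>)"
  \<comment> \<open>The thresholds have sum below 1, so without free mass the complement masses,
    which then add up to 1, cannot all stay below them.\<close>
  define \<epsilon> where "\<epsilon> i = (1/2 :: real) ^ (i + 2)" for i :: nat
  define v where "v a i = max 0 (complement_mass a i - \<epsilon> i)" for a i
  \<comment> \<open>The product cuts off every index after the first vanishing mass, and at that
    index itself both factors are positive.\<close>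
  define u where "u a i = max 0 (\<epsilon> i - complement_mass a i) * (\<Prod>j<i. complement_mass a j)" for a i
  have \<epsilon>0: "0 < \<epsilon> i" for i by (simp add: \<epsilon>_def)
  have finB: "finite {i. \<exists>H\<in>C. complementary G H (N i)}" if "finite C" "C \<subseteq> P" for C
  proof -
    have "{i. \<exists>H\<in>C. complementary G H (N i)} = (\<Union>H\<in>C. {i. i \<in> J \<and> complementary G H (N i)})"
      unfolding J by blast
    then show ?thesis using that finite_complement_index by auto
  qed
  have mass0: "complement_mass a i = 0"
    if "{H. a H \<noteq> 0} \<subseteq> C" "i \<notin> {i. \<exists>H\<in>C. complementary G H (N i)}" for a C i
  proof -
    have "{H. a H \<noteq> 0 \<and> complementary G H (N i)} = {}" using that by blast
    then show ?thesis by (simp only: complement_mass_def sum.empty)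
  qed
  have ex0: "\<exists>n. complement_mass a n = 0" if a: "a \<in> realization_points P (\<subseteq>)" for a
    using ex_new_if_finite[OF infinite_UNIV_nat finB[OF realization_points_memD(3,2)[OF a]]]
      mass0[OF order_refl] by blast
  have upos: "\<exists>i\<in>J. u a i \<noteq> 0" if a: "a \<in> realization_points P (\<subseteq>)" for a
  proof -
    define n where "n = (LEAST n. complement_mass a n = 0)"
    have "complement_mass a n = 0" unfolding n_def using ex0[OF a] by (rule LeastI_ex)
    moreover have "complement_mass a j \<noteq> 0" if "j < n" for j
      using not_less_Least[OF that[unfolded n_def]] .
    ultimately have "u a n \<noteq> 0" using \<epsilon>0[of n] by (simp add: u_def prod_zero_iff)
    then show ?thesis unfolding J by blast
  qed
  have vpos: "\<exists>H. a H \<noteq> 0 \<and> (\<forall>i\<in>J. complementary G H (N i) \<longrightarrow> v a i \<noteq> 0)"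
    if a: "a \<in> realization_points P (\<subseteq>)" for a
  proof (rule exists_undamped[OF a], rule ccontr)
    assume neg: "\<not> (free_mass a \<noteq> 0 \<or> (\<exists>i\<in>J. complement_mass a i \<noteq> 0 \<and> v a i \<noteq> 0))"
    have le: "complement_mass a i \<le> \<epsilon> i" for i
    proof (rule ccontr)
      assume "\<not> complement_mass a i \<le> \<epsilon> i"
      then have "complement_mass a i \<noteq> 0" "v a i \<noteq> 0" using \<epsilon>0[of i] by (auto simp: v_def)
      then show False using neg J by blast
    qed
    let ?B = "{i. \<exists>H\<in>{H. a H \<noteq> 0}. complementary G H (N i)}"
    have fB: "finite ?B" using finB[OF realization_points_memD(3,2)[OF a]] .
    obtain m where mB: "?B \<subseteq> {..<m}" using finite_nat_bounded[OF fB] ..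
    have "free_mass a + (\<Sum>i\<in>{..<m}. complement_mass a i) = 1"
    proof (rule mass_total[OF a])
      show "complement_mass a i = 0" if "i \<in> J - {..<m}" for i
        using mass0[of a "{H. a H \<noteq> 0}" i] mB that by blast
    qed (auto simp: J)
    then have "1 = (\<Sum>i<m. complement_mass a i)" using neg by simp
    also have "\<dots> \<le> (\<Sum>i<m. \<epsilon> i)" using le by (intro sum_mono)
    also have "\<dots> < 1" unfolding \<epsilon>_def sum_half_powers
    proof -
      have "0 < (1/2::real) ^ (m + 1)" by simp
      then show "1/2 - (1/2) ^ (m + 1) < (1::real)" by linarith
    qed
    finally show False by simp
  qed
  have D: "finitary_map T P (\<subseteq>) (\<lambda>a. normalize_weights (damp (v a) a))"
    "finitary_map T P (\<subseteq>) (\<lambda>a. normalize_weights (spread (u a)))"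
    "finitary_map T P (\<subseteq>) (\<lambda>a K. if K = N 0 then 1 else 0)"
    "\<And>a. a \<in> topspace T \<Longrightarrow> mixable G a (normalize_weights (damp (v a) a))"
    "\<And>a. a \<in> topspace T \<Longrightarrow>
      mixable G (normalize_weights (damp (v a) a)) (normalize_weights (spread (u a)))"
    "\<And>a. a \<in> topspace T \<Longrightarrow>
      mixable G (normalize_weights (spread (u a))) (\<lambda>K. if K = N 0 then 1 else 0)"
    if C: "finite C" "C \<subseteq> P" "is_chain_in (\<subseteq>) C"
      and T: "T = subtopology (powertop_real UNIV) (realization_simplex P (\<subseteq>) C)" for C T
  proof -
    have id: "finitary_map T P (\<subseteq>) (\<lambda>a. a)" unfolding T by (rule finitary_map_simplex_id[OF C])
    have pt: "a \<in> realization_points P (\<subseteq>)" if "a \<in> topspace T" for a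
      using id that unfolding finitary_map_def by blast
    have cm: "continuous_map T euclideanreal (\<lambda>a. complement_mass a i)" for i
      unfolding complement_mass_def by (rule continuous_map_mass[OF id])
    \<comment> \<open>No member of \<open>C\<close> complements \<open>N n\<close>, so the mass at
      \<open>n\<close> vanishes on the whole simplex and \<open>{..n}\<close> contains the support
      of \<open>u\<close> for all its points.\<close>
    obtain n where n: "n \<notin> {i. \<exists>H\<in>C. complementary G H (N i)}"
      using ex_new_if_finite[OF infinite_UNIV_nat finB[OF C(1,2)]] by blast
    have data: "\<And>i. i \<in> J \<Longrightarrow> continuous_map T euclideanreal (\<lambda>a. v a i)"
      "\<And>i. i \<in> J \<Longrightarrow> continuous_map T euclideanreal (\<lambda>a. u a i)"
      "\<And>a i. a \<in> topspace T \<Longrightarrow> i \<in> J \<Longrightarrow> 0 \<le> v a i"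
      "\<And>a i. a \<in> topspace T \<Longrightarrow> i \<in> J \<Longrightarrow> 0 \<le> u a i"
      "finite {..n}" "{..n} \<subseteq> J" "\<And>a i. a \<in> topspace T \<Longrightarrow> i \<in> J - {..n} \<Longrightarrow> u a i = 0"
      "\<And>a i. a \<in> topspace T \<Longrightarrow> i \<in> J \<Longrightarrow> v a i = 0 \<or> u a i = 0"
      "\<And>a. a \<in> topspace T \<Longrightarrow> \<exists>i\<in>J. u a i \<noteq> 0"
      "\<And>a. a \<in> topspace T \<Longrightarrow>
        \<exists>H. a H \<noteq> 0 \<and> (\<forall>i\<in>J. complementary G H (N i) \<longrightarrow> v a i \<noteq> 0)"
    proof -
      show "continuous_map T euclideanreal (\<lambda>a. v a i)" for i
        unfolding v_def using cm by (intro continuous_map_real_max continuous_map_diff) auto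
      show "continuous_map T euclideanreal (\<lambda>a. u a i)" for i
        unfolding u_def using cm
        by (intro continuous_map_real_mult continuous_map_prod continuous_map_real_max
            continuous_map_diff) auto
      show "0 \<le> v a i" for a i by (simp add: v_def)
      show "0 \<le> u a i" if "a \<in> topspace T" for a i
        unfolding u_def using complement_mass_nonneg[OF pt[OF that]]
        by (intro mult_nonneg_nonneg prod_nonneg) auto
      show "finite {..n}" "{..n} \<subseteq> J" by (auto simp: J)
      show "u a i = 0" if a: "a \<in> topspace T" and i: "i \<in> J - {..n}" for a i
      proof -
        have "{H. a H \<noteq> 0} \<subseteq> C" using a unfolding T by (simp add: realization_simplex_def)
        then have "complement_mass a n = 0" using mass0[OF _ n] by blast
        moreover have "n < i" using i by simp
        ultimately have "(\<Prod>j<i. complement_mass a j) = 0" by (intro prod_zero) auto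
        then show ?thesis by (simp add: u_def)
      qed
      show "v a i = 0 \<or> u a i = 0" for a i
      proof (cases "complement_mass a i \<le> \<epsilon> i")
        case True
        then show ?thesis by (simp add: v_def)
      qed (simp add: u_def)
      show "\<exists>i\<in>J. u a i \<noteq> 0" if "a \<in> topspace T" for a using upos[OF pt[OF that]] .
      show "\<exists>H. a H \<noteq> 0 \<and> (\<forall>i\<in>J. complementary G H (N i) \<longrightarrow> v a i \<noteq> 0)"
        if "a \<in> topspace T" for a using vpos[OF pt[OF that]] .
    qed
    have k: "0 \<in> J" by (simp add: J)
    note nd = nullhomotopy_data[where u = u and c = v and f = "\<lambda>a. a", OF id data k]
    show "finitary_map T P (\<subseteq>) (\<lambda>a. normalize_weights (damp (v a) a))" by (rule nd(1); assumption)
    show "finitary_map T P (\<subseteq>) (\<lambda>a. normalize_weights (spread (u a)))" by (rule nd(2); assumption)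
    show "finitary_map T P (\<subseteq>) (\<lambda>a K. if K = N 0 then 1 else 0)" by (rule nd(3); assumption)
    show "mixable G a (normalize_weights (damp (v a) a))" if "a \<in> topspace T" for a
      by (rule nd(4); (assumption | fact that))
    show "mixable G (normalize_weights (damp (v a) a)) (normalize_weights (spread (u a)))"
      if "a \<in> topspace T" for a by (rule nd(5); (assumption | fact that))
    show "mixable G (normalize_weights (spread (u a))) (\<lambda>K. if K = N 0 then 1 else 0)"
      if "a \<in> topspace T" for a by (rule nd(6); (assumption | fact that))
  qed
  have supp: "finite {H. a H \<noteq> 0}" "{H. a H \<noteq> 0} \<subseteq> P" "is_chain_in (\<subseteq>) {H. a H \<noteq> 0}"
    "a \<in> topspace (subtopology (powertop_real UNIV) (realization_simplex P (\<subseteq>) {H. a H \<noteq> 0}))"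
    if "a \<in> realization_points P (\<subseteq>)" for a
    using realization_points_memD[OF that] that by (simp_all add: realization_simplex_def)
  note M = D(4-6)[OF supp(1-3) refl supp(4)]
  have h1: "homotopic_with (\<lambda>_. True) ?R ?R (\<lambda>a. a) (\<lambda>a. normalize_weights (damp (v a) a))"
    by (rule homotopic_with_mix_realization[OF G finitary_map_simplex_id D(1)[OF _ _ _ refl] M(1)])
  have h2: "homotopic_with (\<lambda>_. True) ?R ?R (\<lambda>a. normalize_weights (damp (v a) a))
      (\<lambda>a. normalize_weights (spread (u a)))"
    by (rule homotopic_with_mix_realization[OF G D(1)[OF _ _ _ refl] D(2)[OF _ _ _ refl] M(2)])
  have h3: "homotopic_with (\<lambda>_. True) ?R ?R (\<lambda>a. normalize_weights (spread (u a)))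
      (\<lambda>a K. if K = N 0 then 1 else 0)"
    by (rule homotopic_with_mix_realization[OF G D(2)[OF _ _ _ refl] D(3)[OF _ _ _ refl] M(3)])
  show ?thesis
    unfolding contractible_space_def id_def
    using homotopic_with_trans[OF homotopic_with_trans[OF h1 h2] h3] by blast
qed

end

section \<open>Chains of normal subgroups\<close>

lemma finite_chain_enumeration:
  fixes \<C> :: "'c set set"
  assumes "finite \<C>" "\<C> \<noteq> {}" "is_chain_in (\<subseteq>) \<C>"
  shows "\<exists>N d. N ` {..d::nat} = \<C> \<and> (\<forall>i<d. N i \<subset> N (Suc i))"
  using assms
proof (induction "card \<C>" arbitrary: \<C> rule: less_induct)
  case less
  obtain U where U: "U \<in> \<C>" "\<And>H. H \<in> \<C> \<Longrightarrow> H \<subseteq> U"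
    using chain_has_least_greatest(2)[OF less.prems] by blast
  show ?case
  proof (cases "\<C> = {U}")
    case True
    then show ?thesis by (intro exI[of _ "\<lambda>_. U"] exI[of _ 0]) auto
  next
    case False
    have "\<exists>N d. N ` {..d::nat} = \<C> - {U} \<and> (\<forall>i<d. N i \<subset> N (Suc i))"
    proof (rule less.hyps)
      show "card (\<C> - {U}) < card \<C>" by (rule card_Diff1_less[OF less.prems(1) U(1)])
      show "\<C> - {U} \<noteq> {}" using False U(1) by blast
      show "is_chain_in (\<subseteq>) (\<C> - {U})" using is_chain_in_subset[OF less.prems(3)] by blast
    qed (use less.prems(1) in simp)
    then obtain N d where N: "N ` {..d::nat} = \<C> - {U}" "\<forall>i<d. N i \<subset> N (Suc i)"
      by (elim exE conjE)
    let ?N = "N(Suc d := U)"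
    have "?N ` {..d} = N ` {..d}" by (rule image_cong) simp_all
    then have "?N ` {..Suc d} = insert U (\<C> - {U})"
      by (simp only: atMost_Suc image_insert N(1) fun_upd_same)
    then have "?N ` {..Suc d} = \<C>" using U(1) by (simp only: insert_Diff)
    moreover have "?N i \<subset> ?N (Suc i)" if "i < Suc d" for i
    proof (cases "i = d")
      case True
      have "N d \<in> \<C> - {U}" using N(1) by blast
      then have "N d \<subset> U" using U(2)[of "N d"] by blast
      then show ?thesis using True by simp
    qed (use N(2) that in simp)
    ultimately show ?thesis by (intro exI[of _ ?N] exI[of _ "Suc d"]) blast
  qed
qed

lemma strict_chain_less:
  fixes N :: "nat \<Rightarrow> 'c set"
  assumes "\<And>i. i < d \<Longrightarrow> N i \<subset> N (Suc i)" "i < j" "j \<le> d"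
  shows "N i \<subset> N j"
  using assms(2,3)
proof (induction j)
  case (Suc j)
  then have "N j \<subset> N (Suc j)" using assms(1) by simp
  then show ?case using Suc by (cases "i = j") auto
qed simp

text \<open>A finite maximal chain of normal subgroups, listed in increasing order, would be a chief
  series, so a maximal chain is infinite here. Any injective sequence of its members other than 1
  and \<open>G\<close> will do, increasing or not.\<close>

lemma infinite_normal_chain:
  fixes G :: "('a, 'b) monoid_scheme"
  assumes G: "group G" and no: "\<not> (\<exists>N d. chief_series G N d)"
  shows "\<exists>N. normal_chain G N UNIV"
proof -
  interpret group G by fact
  let ?A = "{M. M \<lhd> G}"
  obtain \<C> where mc: "pred_on.maxchain ?A (\<subset>) \<C>" using pred_on.Hausdorff by blast
  have \<C>: "\<C> \<subseteq> ?A" "is_chain_in (\<subseteq>) \<C>"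
    using mc unfolding pred_on.maxchain_def pred_on.chain_def is_chain_in_def by auto
  have ins: "M \<in> \<C>" if "M \<lhd> G" "\<And>K. K \<in> \<C> \<Longrightarrow> M \<subseteq> K \<or> K \<subseteq> M" for M
  proof (rule ccontr)
    assume "M \<notin> \<C>"
    moreover have "pred_on.chain ?A (\<subset>) (insert M \<C>)"
      using that \<C> unfolding pred_on.chain_def is_chain_in_def by blast
    ultimately show False using mc unfolding pred_on.maxchain_def by blast
  qed
  have sub: "subgroup K G" if "K \<in> \<C>" for K using that \<C>(1) normal_imp_subgroup by blast
  have one: "{\<one>\<^bsub>G\<^esub>} \<in> \<C>"
    using ins[OF one_is_normal] subgroup.one_closed[OF sub] by blast
  have car: "carrier G \<in> \<C>"
    using ins[OF normal_self] subgroup.subset[OF sub] by blast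
  have "infinite \<C>"
  proof
    assume "finite \<C>"
    moreover have "\<C> \<noteq> {}" using one by blast
    ultimately have "\<exists>N d. N ` {..d::nat} = \<C> \<and> (\<forall>i<d. N i \<subset> N (Suc i))"
      using \<C>(2) by (rule finite_chain_enumeration)
    then obtain N d where N: "N ` {..d::nat} = \<C>" "\<forall>i<d. N i \<subset> N (Suc i)"
      by (elim exE conjE)
    have NC: "N i \<in> \<C>" if "i \<le> d" for i using N(1) that by blast
    have less: "N i \<subset> N j" if "i < j" "j \<le> d" for i j
      using strict_chain_less[of d N, OF _ that] N(2) by blast
    have "chief_series G N d"
      unfolding chief_series_def
    proof (intro conjI allI impI)
      show "N i \<lhd> G" if "i \<le> d" for i using NC[OF that] \<C>(1) by blast
      obtain j where j: "j \<le> d" "N j = {\<one>\<^bsub>G\<^esub>}" using one N(1) by auto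
      show "N 0 = {\<one>\<^bsub>G\<^esub>}"
      proof (cases "j = 0")
        case False
        then have "N 0 \<subset> N j" using less j(1) by blast
        then show ?thesis using subgroup.one_closed[OF sub[OF NC[of 0]]] j(2) by blast
      qed (use j in simp)
      obtain l where l: "l \<le> d" "N l = carrier G" using car N(1) by auto
      show "N d = carrier G"
      proof (cases "l = d")
        case False
        then have "N l \<subset> N d" using less[of l d] l(1) by simp
        then show ?thesis using subgroup.subset[OF sub[OF NC[of d]]] l(2) by blast
      qed (use l in simp)
      show "N i \<subset> N (Suc i)" if "i < d" for i using N(2) that by blast
      \<comment> \<open>A normal subgroup strictly between consecutive terms is comparable with
        every member, hence a member by maximality; but it is also different from every
        member.\<close>
      show "\<not> (\<exists>M. M \<lhd> G \<and> N i \<subset> M \<and> M \<subset> N (Suc i))" if i: "i < d" for i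
      proof
        assume "\<exists>M. M \<lhd> G \<and> N i \<subset> M \<and> M \<subset> N (Suc i)"
        then obtain M where M: "M \<lhd> G" "N i \<subset> M" "M \<subset> N (Suc i)" by blast
        have cmp: "N j \<subset> M \<or> M \<subset> N j" if "j \<le> d" for j
        proof (cases "j \<le> i")
          case True
          then have "N j \<subseteq> N i" using less[of j i] i by (cases "j = i") auto
          then show ?thesis using M(2) by blast
        next
          case False
          then have "N (Suc i) \<subseteq> N j" using less[of "Suc i" j] that by (cases "j = Suc i") auto
          then show ?thesis using M(3) by blast
        qed
        then have "M \<in> \<C>" using ins[OF M(1)] N(1) by blast
        then show False using cmp N(1) by blast
      qed
    qed
    then show False using no by blast
  qed
  then have "infinite (\<C> - {{\<one>\<^bsub>G\<^esub>}, carrier G})" by simp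
  from infinite_countable_subset[OF this]
  obtain N :: "nat \<Rightarrow> 'a set" where N: "inj N" "range N \<subseteq> \<C> - {{\<one>\<^bsub>G\<^esub>}, carrier G}"
    by (elim exE conjE)
  have "N i \<in> \<C> - {{\<one>\<^bsub>G\<^esub>}, carrier G}" for i using N(2) by (rule subsetD) (rule rangeI)
  then have NC: "N i \<in> \<C>" "N i \<noteq> {\<one>\<^bsub>G\<^esub>}" "N i \<noteq> carrier G" for i by simp_all
  have "normal_chain G N UNIV"
  proof (rule normal_chain.intro[OF G])
    show "N i \<lhd> G" for i using NC(1) \<C>(1) by blast
    show "N i \<in> proper_nontrivial_subgroups G" for i
      unfolding proper_nontrivial_subgroups_def using NC sub by blast
    show "inj_on N UNIV" by (rule N(1))
    show "N i \<subseteq> N j \<or> N j \<subseteq> N i" for i j using \<C>(2) NC(1) unfolding is_chain_in_def by blast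
  qed
  then show ?thesis by (rule exI[of _ N])
qed

text \<open>The shift drops the trivial term and the bound \<open>d - 1\<close> drops the whole
  group, which leaves \<open>d - 1\<close> members; truncated subtraction gives the empty chain for
  \<open>d = 0\<close>.\<close>

lemma chief_series_normal_chain:
  assumes "group G" "chief_series G N d"
  shows "normal_chain G (\<lambda>i. N (Suc i)) {..<d - 1}"
proof (rule normal_chain.intro[OF assms(1)])
  interpret group G by fact
  have strict: "N i \<subset> N j" if "i < j" "j \<le> d" for i j
    using assms(2) by (intro strict_chain_less[OF _ that]) (simp add: chief_series_def)
  have N: "\<And>i. i \<le> d \<Longrightarrow> N i \<lhd> G" "N 0 = {\<one>\<^bsub>G\<^esub>}" "N d = carrier G"
    using assms(2) by (simp_all add: chief_series_def)
  show "N (Suc i) \<lhd> G" if "i \<in> {..<d - 1}" for i using N(1) that by simp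
  show "N (Suc i) \<in> proper_nontrivial_subgroups G" if "i \<in> {..<d - 1}" for i
  proof -
    have "N 0 \<subset> N (Suc i)" "N (Suc i) \<subset> N d" using that by (auto intro!: strict)
    moreover have "subgroup (N (Suc i)) G" using that by (intro normal_imp_subgroup N(1)) auto
    ultimately show ?thesis unfolding proper_nontrivial_subgroups_def using N(2,3) by blast
  qed
  show "inj_on (\<lambda>i. N (Suc i)) {..<d - 1}"
  proof (rule linorder_inj_onI')
    fix i j assume "i \<in> {..<d - 1}" "j \<in> {..<d - 1}" "i < j"
    then have "N (Suc i) \<subset> N (Suc j)" by (intro strict) auto
    then show "N (Suc i) \<noteq> N (Suc j)" by blast
  qed
  show "N (Suc i) \<subseteq> N (Suc j) \<or> N (Suc j) \<subseteq> N (Suc i)"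
    if "i \<in> {..<d - 1}" "j \<in> {..<d - 1}" for i j
  proof (cases i j rule: linorder_cases)
    case less
    then have "N (Suc i) \<subset> N (Suc j)" using that by (intro strict) auto
    then show ?thesis by blast
  next
    case greater
    then have "N (Suc j) \<subset> N (Suc i)" using that by (intro strict) auto
    then show ?thesis by blast
  qed simp
qed

lemma realization_nonempty:
  assumes "H \<in> proper_nontrivial_subgroups G"
  shows "topspace (order_complex_realization (proper_nontrivial_subgroups G) (\<subseteq>)) \<noteq> {}"
proof -
  have s: "{K. (if K = H then 1 else 0 :: real) \<noteq> 0} = {H}" by auto
  have "(\<lambda>K. if K = H then 1 else 0) \<in> realization_points (proper_nontrivial_subgroups G) (\<subseteq>)"
    unfolding realization_points_def mem_Collect_eq s using assms by (auto simp: is_chain_in_def)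
  then show ?thesis by auto
qed

theorem mainTheorem18:
  fixes G :: "('a, 'b) monoid_scheme"
  assumes "group G"
  shows "(\<forall>n::int. (chief_length G = \<infinity> \<or> n \<le> int (the_enat (chief_length G)) - 3) \<longrightarrow>
            n_connected_space n (order_complex_realization (proper_nontrivial_subgroups G) (\<subseteq>)))
         \<and> (chief_length G = \<infinity> \<longrightarrow>
            contractible_space (order_complex_realization (proper_nontrivial_subgroups G) (\<subseteq>)))"
proof (cases "\<exists>N d. chief_series G N d")
  case True
  define d where "d = (LEAST d. \<exists>N. chief_series G N d)"
  have len: "chief_length G = enat d" using True unfolding chief_length_def d_def by simp
  have "\<exists>d. \<exists>N. chief_series G N d" using True by metis
  then have "\<exists>N. chief_series G N d" unfolding d_def by (rule LeastI_ex)
  then obtain N where N: "chief_series G N d" by (elim exE)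
  interpret normal_chain G "\<lambda>i. N (Suc i)" "{..<d - 1}"
    using chief_series_normal_chain[OF assms N] .
  have "n_connected_space n (order_complex_realization (proper_nontrivial_subgroups G) (\<subseteq>))"
    if n: "n \<le> int d - 3" for n
    unfolding n_connected_space_def
  proof (intro conjI impI allI)
    assume "0 \<le> n + 1"
    then have "0 \<in> {..<d - 1}" using n by simp
    then show "topspace (order_complex_realization (proper_nontrivial_subgroups G) (\<subseteq>)) \<noteq> {}"
      by (rule realization_nonempty[OF proper])
  next
    fix k :: nat and f
    assume k: "of_nat k \<le> n"
      and f: "continuous_map (nsphere k) (order_complex_realization (proper_nontrivial_subgroups G) (\<subseteq>)) f"
    \<comment> \<open>Here the 3 in the bound is spent: one for the terms lost at the ends of the
      series, since \<open>d + 1\<close> terms leave \<open>d - 1\<close> proper ones, and two for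
      the dimension count on the sphere.\<close>
    have "k + 2 \<le> d - 1" using k n by linarith
    then show "\<exists>c. homotopic_with (\<lambda>_. True) (nsphere k)
        (order_complex_realization (proper_nontrivial_subgroups G) (\<subseteq>)) f (\<lambda>_. c)"
      by (rule nullhomotopic_nsphere[OF refl _ f])
  qed
  then show ?thesis unfolding len by simp
next
  case False
  from infinite_normal_chain[OF assms False] obtain N where "normal_chain G N UNIV" ..
  then interpret normal_chain G N UNIV .
  have contr: "contractible_space (order_complex_realization (proper_nontrivial_subgroups G) (\<subseteq>))"
    by (rule contractible_realization) simp
  have "n_connected_space n (order_complex_realization (proper_nontrivial_subgroups G) (\<subseteq>))" for n
    unfolding n_connected_space_def
  proof (intro conjI impI allI)
    show "topspace (order_complex_realization (proper_nontrivial_subgroups G) (\<subseteq>)) \<noteq> {}"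
      using realization_nonempty[OF proper[of 0]] by simp
    fix k :: nat and f
    assume "continuous_map (nsphere k) (order_complex_realization (proper_nontrivial_subgroups G) (\<subseteq>)) f"
    then show "\<exists>c. homotopic_with (\<lambda>_. True) (nsphere k)
        (order_complex_realization (proper_nontrivial_subgroups G) (\<subseteq>)) f (\<lambda>_. c)"
      using nullhomotopic_into_contractible_space[OF _ contr] by blast
  qed
  then show ?thesis using contr by blast
qed

end
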